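(* Under the assumptions listed in the context, let $\{(p_k,c_k)\}_{k\ge1}$ be the sequence generated by the AIP.AL method (described in the context), and let $$\kappa_0=2\left[K_h+B_f^{(1)}\right]D_z+\left[\frac{\theta^2}{2(1-\theta)^2}+2\left(\frac{1+\theta}{1-\theta}\right)\right]\frac{D_z^2}\lambda,\qquad \bar d=\operatorname{dist}(\bar z,\partial Z).$$ Then: (a) for every $k\ge1$, $$\min\{1,\bar d\}\,\tau\|p_k\|+\frac{\|p_k\|^2}{c_k}\le\kappa_0+\frac1{c_k}\langle p_k,p_{k-1}\rangle;$$ (b) for every $k\ge0$, $$\|p_k\|\le C_0:=\frac{\max\{\|p_0\|,\kappa_0\}}{\min\{1,\bar d\}\,\tau}.$$
   Context: Notation. $\mathcal Z$ is a finite dimensional inner product space. $\overline{\mathrm{Conv}}(Z)$: proper lower semicontinuous convex functions $\mathcal Z\to(-\infty,\infty]$ real-valued exactly on $Z$. $\ell_F(u;z)=F(z)+\langle\nabla F(z),u-z\rangle$. $\mathcal C_{m,M}(Z)$: functions continuously differentiable on $Z$ (finite on an open set containing $Z$) with $-\frac m2\|u-z\|^2\le f(u)-\ell_f(u;z)\le\frac M2\|u-z\|^2$ for $u,z\in Z$. $\mathcal K\subseteq\mathbb R^\ell$ is a closed convex cone, $\mathcal K^+$ its dual cone, $a\preceq_{\mathcal K}b$ means $b-a\in\mathcal K$; $\nabla g(z)$ is the transpose of the Jacobian of $g$. $\Pi_C$ is the projection onto $C$; $\partial Z$ (for a set $Z$) is its boundary. For a differentiable $\Psi$, $B_\Psi^{(0)}=\sup_{z\in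 Z}\|\Psi(z)\|$, $B_\Psi^{(1)}=\sup_{z\in Z}\|\nabla\Psi(z)\|$. Assumptions. (i) $h\in\overline{\mathrm{Conv}}(Z)$ with $Z$ nonempty, convex and compact of diameter $D_z$, and $h$ is $K_h$-Lipschitz continuous on $Z$, $K_h>0$; (ii) $f\in\mathcal C_{m,M}(Z)$ with $0<m\le M$; (iii) $g:\mathcal Z\to\mathbb R^\ell$ is continuously differentiable, $\mathcal K$-convex (i.e. $g(tu+(1-t)z)\preceq_{\mathcal K}tg(u)+(1-t)g(z)$ for $t\in[0,1]$), and $\|\nabla g(u)-\nabla g(z)\|\le L_g\|u-z\|$ for all $u,z$, with $L_g>0$; (iv) there are $\bar z\in\operatorname{int}Z$ and $\tau\in(0,1]$ with $g(\bar z)\preceq_{\mathcal K}0$ and $\max\{\|\nabla g(z)p\|,|\langle g(\bar z),p\rangle|\}\ge\tau\|p\|$ for all $z\in Z$, $p\in\mathcal K^+$. Inputs: $\hat\rho,\hat\eta>0$, $\lambda\in(0,1/m)$, $\theta\in(0,1/\sqrt2]$, $c_1>0$, $(z_0,p_0)\in Z\times\mathbb R^\ell$. Lagrangian. $\widetilde{\mathcal L}_c(z;p)=f(z)+\frac1{2c}[\operatorname{dist}^2(p+cg(z),-\mathcal K)-\|p\|^2]$, $\mathcal L_c=\widetilde{\mathcal L}_c+h$, and $\widetilde L(c,p)=M+L_g\|p\|+c(B_g^{(0)}L_g+[B_g^{(1)}]^2)$. ACG iterations with inputs $(\psi_s,\psi_n,y_0,\mu,L)$: $\psi=\psi_s+\psi_n$,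 $A_0=0$, $\Gamma_0\equiv0$, $x_0=y_0$, and for $k\ge1$: $\tau_{k-1}=(1+\mu A_{k-1})/L$, $a_{k-1}=\frac12(\tau_{k-1}+\sqrt{\tau_{k-1}^2+4\tau_{k-1}A_{k-1}})$, $A_k=A_{k-1}+a_{k-1}$, $\tilde x_{k-1}=\frac{A_{k-1}}{A_k}y_{k-1}+\frac{a_{k-1}}{A_k}x_{k-1}$, $q_k=\ell_{\psi_s}(\cdot;\tilde x_{k-1})+\psi_n+\frac\mu2\|\cdot-\tilde x_{k-1}\|^2$, $y_k=\operatorname{argmin}_y\{\frac1Lq_k(y)+\frac12\|y-\tilde x_{k-1}\|^2\}$, $x_k=x_{k-1}+\frac{a_{k-1}}{1+\mu A_k}[L(y_k-\tilde x_{k-1})+\mu(y_k-x_{k-1})]$, $\gamma_{k-1}=q_k(y_k)+L\langle\tilde x_{k-1}-y_k,\cdot-y_k\rangle+\frac\mu2\|\cdot-y_k\|^2$, $\Gamma_k=\frac{A_{k-1}}{A_k}\Gamma_{k-1}+\frac{a_{k-1}}{A_k}\gamma_{k-1}$, $r_k=(x_0-x_k)/A_k$, $\eta_k=\psi(y_k)-\Gamma_k(x_k)-\langle r_k,y_k-x_k\rangle$. ACG3, with extra input $\sigma$, returns $(y_k,r_k,\eta_k)$ at the first $k$ with $\|r_k\|^2+2\eta_k\le\sigma\|y_0-y_k+r_k\|^2$. AIP.AL method: set $\mu=1-\lambda m$, $\hat k=0$. For $k=1,2,\dots$: (1) $\psi_s^k=\lambda\widetilde{\mathcal L}_{c_k}(\cdot;p_{k-1})+\frac12\|\cdot-z_{k-1}\|^2$,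 $L_{k-1}^\psi=\lambda\widetilde L(c_k,p_{k-1})+1$, $\sigma_{k-1}=\theta^2/L^\psi_{k-1}$; let $(z_k,\tilde v_k,\tilde\varepsilon_k)$ be the output of ACG3 with inputs $(\psi_s^k,\lambda h,z_{k-1},\mu,L_{k-1}^\psi)$ and $\sigma=\sigma_{k-1}$. (2) With $F=\widetilde{\mathcal L}_{c_k}(\cdot;p_{k-1})$ and $\bar L=L_{k-1}^\psi/\lambda$: $\hat z_k=\operatorname{argmin}_u\{\ell_F(u;z_k)+h(u)+\frac{\bar L}2\|u-z_k\|^2\}$, $\hat v_k=\bar L(z_k-\hat z_k)+\nabla F(\hat z_k)-\nabla F(z_k)$; $p_k=\Pi_{\mathcal K^+}(p_{k-1}+c_kg(z_k))$, $\hat p_k=\Pi_{\mathcal K^+}(p_{k-1}+c_kg(\hat z_k))$, $\hat q_k=(p_{k-1}-\hat p_k)/c_k$. If $\|\hat v_k\|\le\hat\rho$ and $\|\hat q_k\|\le\hat\eta$, stop. (3) If $k>\hat k+1$ and $\Delta_k:=[\mathcal L_{c_k}(z_{\hat k+1};p_{\hat k+1})-\mathcal L_{c_k}(z_k;p_k)]/(k-\hat k-1)\le\lambda(1-\theta)\hat\rho^2/36$, set $c_{k+1}=2c_k$ and $\hat k=k$; otherwise $c_{k+1}=c_k$. (The indices $k$ in the claim range over the iterations actually performed.)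
   Formalization: Added assumption: at every point x̃ where ACG linearises (these may leave Z, where the claim can fail or ∇f be undefined), f is differentiable and f(u) − ℓ_f(u;x̃) ≥ −(m/2)‖u−x̃‖² for all u in Z. *)

theory Defs
  imports "HOL-Analysis.Analysis"
begin

section \<open>Gradients and function classes\<close>

definition grad :: "('a::real_inner \<Rightarrow> real) \<Rightarrow> 'a \<Rightarrow> 'a" where
  "grad F z = (THE D. GDERIV F z :> D)"

definition linearization :: "('a::real_inner \<Rightarrow> real) \<Rightarrow> 'a \<Rightarrow> 'a \<Rightarrow> real" where
  "linearization F z u = F z + grad F z \<bullet> (u - z)"

text \<open>For a vector-valued map the gradient is the transpose of the Jacobian. As a bounded linear
  function it carries the operator norm.\<close>

definition grad_map :: "('a::euclidean_space \<Rightarrow> 'b::euclidean_space) \<Rightarrow> 'a \<Rightarrow> 'b \<Rightarrow>\<^sub>L 'a" where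
  "grad_map g z = Blinfun (adjoint (frechet_derivative g (at z)))"

text \<open>Proper lower semicontinuous convex functions that are finite exactly on \<open>Z\<close>.\<close>

definition Conv_bar :: "'a::euclidean_space set \<Rightarrow> ('a \<Rightarrow> ereal) set" where
  "Conv_bar Z = {h.
     (\<forall>z. h z \<noteq> -\<infinity>) \<and> (\<exists>z. h z \<noteq> \<infinity>) \<and>
     (\<forall>z. h z \<le> Liminf (at z) h) \<and>
     (\<forall>u z. \<forall>t\<in>{0<..<1}. h (t *\<^sub>R u + (1 - t) *\<^sub>R z) \<le> ereal t * h u + ereal (1 - t) * h z) \<and>
     {z. h z \<noteq> \<infinity>} = Z}"

text \<open>Functions are total here, so finiteness near \<open>Z\<close> is automatic. The values away from \<open>Z\<close> are
  unconstrained, and derivatives are taken in the full space.\<close>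

definition C_class :: "real \<Rightarrow> real \<Rightarrow> 'a::euclidean_space set \<Rightarrow> ('a \<Rightarrow> real) set" where
  "C_class m M Z = {f.
     (\<forall>z\<in>Z. f differentiable (at z)) \<and> continuous_on Z (grad f) \<and>
     (\<forall>u\<in>Z. \<forall>z\<in>Z. - (m / 2) * (norm (u - z))\<^sup>2 \<le> f u - linearization f z u \<and>
                     f u - linearization f z u \<le> M / 2 * (norm (u - z))\<^sup>2)}"

section \<open>Cones and the augmented Lagrangian\<close>

definition dual_cone :: "'b::real_inner set \<Rightarrow> 'b set" where
  "dual_cone K = {p. \<forall>x\<in>K. 0 \<le> x \<bullet> p}"

definition cone_le :: "'b::real_vector set \<Rightarrow> 'b \<Rightarrow> 'b \<Rightarrow> bool" where
  "cone_le K a b \<longleftrightarrow> b - a \<in> K"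

definition cone_convex :: "'b::real_vector set \<Rightarrow> ('a::real_vector \<Rightarrow> 'b) \<Rightarrow> bool" where
  "cone_convex K g \<longleftrightarrow> (\<forall>u z. \<forall>t\<in>{0..1}.
     cone_le K (g (t *\<^sub>R u + (1 - t) *\<^sub>R z)) (t *\<^sub>R g u + (1 - t) *\<^sub>R g z))"

definition AL_smooth ::
  "('a::euclidean_space \<Rightarrow> real) \<Rightarrow> ('a \<Rightarrow> 'b::euclidean_space) \<Rightarrow> 'b set \<Rightarrow> real \<Rightarrow> 'b \<Rightarrow> 'a \<Rightarrow> real"
  where "AL_smooth f g K c p z =
     f z + 1 / (2 * c) * ((infdist (p + c *\<^sub>R g z) (uminus ` K))\<^sup>2 - (norm p)\<^sup>2)"

definition AL ::
  "('a::euclidean_space \<Rightarrow> real) \<Rightarrow> ('a \<Rightarrow> ereal) \<Rightarrow> ('a \<Rightarrow> 'b::euclidean_space) \<Rightarrow> 'b set \<Rightarrow>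
   real \<Rightarrow> 'a \<Rightarrow> 'b \<Rightarrow> ereal"
  where "AL f h g K c z p = ereal (AL_smooth f g K c p z) + h z"

definition AL_curv ::
  "real \<Rightarrow> real \<Rightarrow> ('a::euclidean_space \<Rightarrow> 'b::euclidean_space) \<Rightarrow> 'a set \<Rightarrow> real \<Rightarrow> 'b \<Rightarrow> real"
  where "AL_curv M L\<^sub>g g Z c p =
     M + L\<^sub>g * norm p +
     c * ((SUP z\<in>Z. norm (g z)) * L\<^sub>g + (SUP z\<in>Z. norm (grad_map g z))\<^sup>2)"

section \<open>Accelerated composite gradient iterations\<close>

text \<open>A state is the quadruple \<open>(A, x, y, \<Gamma>)\<close>. The affine/quadratic minorant \<open>\<Gamma>\<close> is
  real-valued because \<open>q\<close> is finite at its minimiser.\<close>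

type_synonym 'a acg_state = "real \<times> 'a \<times> 'a \<times> ('a \<Rightarrow> real)"

definition acg_a :: "real \<Rightarrow> real \<Rightarrow> 'a acg_state \<Rightarrow> real" where
  "acg_a \<mu> L s = (case s of (A, x, y, \<Gamma>) \<Rightarrow>
     let \<tau> = (1 + \<mu> * A) / L in (\<tau> + sqrt (\<tau>\<^sup>2 + 4 * \<tau> * A)) / 2)"

definition acg_extrap :: "real \<Rightarrow> real \<Rightarrow> 'a::real_vector acg_state \<Rightarrow> 'a" where
  "acg_extrap \<mu> L s = (case s of (A, x, y, \<Gamma>) \<Rightarrow>
     let a = acg_a \<mu> L s in (A / (A + a)) *\<^sub>R y + (a / (A + a)) *\<^sub>R x)"

definition acg_step ::
  "('a::euclidean_space \<Rightarrow> real) \<Rightarrow> ('a \<Rightarrow> ereal) \<Rightarrow> real \<Rightarrow> real \<Rightarrow> 'a acg_state \<Rightarrow> 'a acg_state"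
  where "acg_step \<psi>\<^sub>s \<psi>\<^sub>n \<mu> L s = (case s of (A, x, y, \<Gamma>) \<Rightarrow>
     let a = acg_a \<mu> L s;
         A' = A + a;
         xt = acg_extrap \<mu> L s;
         q = (\<lambda>u. ereal (linearization \<psi>\<^sub>s xt u) + \<psi>\<^sub>n u + ereal (\<mu> / 2 * (norm (u - xt))\<^sup>2));
         y' = (ARG_MIN (\<lambda>u. ereal (1 / L) * q u + ereal (1 / 2 * (norm (u - xt))\<^sup>2)) u. True);
         x' = x + (a / (1 + \<mu> * A')) *\<^sub>R (L *\<^sub>R (y' - xt) + \<mu> *\<^sub>R (y' - x));
         \<gamma> = (\<lambda>u. real_of_ereal (q y') + L * ((xt - y') \<bullet> (u - y')) + \<mu> / 2 * (norm (u - y'))\<^sup>2);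
         \<Gamma>' = (\<lambda>u. A / A' * \<Gamma> u + a / A' * \<gamma> u)
     in (A', x', y', \<Gamma>'))"

primrec acg ::
  "('a::euclidean_space \<Rightarrow> real) \<Rightarrow> ('a \<Rightarrow> ereal) \<Rightarrow> 'a \<Rightarrow> real \<Rightarrow> real \<Rightarrow> nat \<Rightarrow> 'a acg_state"
  where
    "acg \<psi>\<^sub>s \<psi>\<^sub>n y\<^sub>0 \<mu> L 0 = (0, y\<^sub>0, y\<^sub>0, \<lambda>_. 0)"
  | "acg \<psi>\<^sub>s \<psi>\<^sub>n y\<^sub>0 \<mu> L (Suc j) = acg_step \<psi>\<^sub>s \<psi>\<^sub>n \<mu> L (acg \<psi>\<^sub>s \<psi>\<^sub>n y\<^sub>0 \<mu> L j)"

text \<open>The triple \<open>(y\<^sub>j, r\<^sub>j, \<eta>\<^sub>j)\<close>.\<close>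

definition acg_triple ::
  "('a::euclidean_space \<Rightarrow> real) \<Rightarrow> ('a \<Rightarrow> ereal) \<Rightarrow> 'a \<Rightarrow> real \<Rightarrow> real \<Rightarrow> nat \<Rightarrow> 'a \<times> 'a \<times> real"
  where "acg_triple \<psi>\<^sub>s \<psi>\<^sub>n y\<^sub>0 \<mu> L j = (case acg \<psi>\<^sub>s \<psi>\<^sub>n y\<^sub>0 \<mu> L j of (A, x, y, \<Gamma>) \<Rightarrow>
     let r = (1 / A) *\<^sub>R (y\<^sub>0 - x);
         \<eta> = real_of_ereal (ereal (\<psi>\<^sub>s y) + \<psi>\<^sub>n y) - \<Gamma> x - r \<bullet> (y - x)
     in (y, r, \<eta>))"

definition acg3_stop ::
  "('a::euclidean_space \<Rightarrow> real) \<Rightarrow> ('a \<Rightarrow> ereal) \<Rightarrow> 'a \<Rightarrow> real \<Rightarrow> real \<Rightarrow> real \<Rightarrow> nat \<Rightarrow> bool"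
  where "acg3_stop \<psi>\<^sub>s \<psi>\<^sub>n y\<^sub>0 \<mu> L \<sigma> j \<longleftrightarrow> (case acg_triple \<psi>\<^sub>s \<psi>\<^sub>n y\<^sub>0 \<mu> L j of (y, r, \<eta>) \<Rightarrow>
     (norm r)\<^sup>2 + 2 * \<eta> \<le> \<sigma> * (norm (y\<^sub>0 - y + r))\<^sup>2)"

text \<open>A call that never meets the stopping test has no output.\<close>

definition acg3_returns ::
  "('a::euclidean_space \<Rightarrow> real) \<Rightarrow> ('a \<Rightarrow> ereal) \<Rightarrow> 'a \<Rightarrow> real \<Rightarrow> real \<Rightarrow> real \<Rightarrow>
   'a \<times> 'a \<times> real \<Rightarrow> bool"
  where "acg3_returns \<psi>\<^sub>s \<psi>\<^sub>n y\<^sub>0 \<mu> L \<sigma> out \<longleftrightarrow> (\<exists>j\<ge>1.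
     acg3_stop \<psi>\<^sub>s \<psi>\<^sub>n y\<^sub>0 \<mu> L \<sigma> j \<and> (\<forall>i\<in>{1..<j}. \<not> acg3_stop \<psi>\<^sub>s \<psi>\<^sub>n y\<^sub>0 \<mu> L \<sigma> i) \<and>
     out = acg_triple \<psi>\<^sub>s \<psi>\<^sub>n y\<^sub>0 \<mu> L j)"

text \<open>The points at which a call linearises \<open>\<psi>\<^sub>s\<close>. The sequence \<open>x\<^sub>j\<close> is produced by
  extrapolation, so these points may leave the domain of \<open>\<psi>\<^sub>n\<close>.\<close>

definition acg3_lin_points ::
  "('a::euclidean_space \<Rightarrow> real) \<Rightarrow> ('a \<Rightarrow> ereal) \<Rightarrow> 'a \<Rightarrow> real \<Rightarrow> real \<Rightarrow> real \<Rightarrow> 'a set"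
  where "acg3_lin_points \<psi>\<^sub>s \<psi>\<^sub>n y\<^sub>0 \<mu> L \<sigma> =
     {acg_extrap \<mu> L (acg \<psi>\<^sub>s \<psi>\<^sub>n y\<^sub>0 \<mu> L j) | j. \<forall>i\<in>{1..j}. \<not> acg3_stop \<psi>\<^sub>s \<psi>\<^sub>n y\<^sub>0 \<mu> L \<sigma> i}"

section \<open>The AIP.AL method\<close>

text \<open>Below \<open>zp\<close>, \<open>pp\<close> stand for the previous iterates \<open>z\<^sub>k\<^sub>-\<^sub>1\<close>, \<open>p\<^sub>k\<^sub>-\<^sub>1\<close>, and \<open>c\<close> for \<open>c\<^sub>k\<close>.\<close>

definition prox_smooth ::
  "('a::euclidean_space \<Rightarrow> real) \<Rightarrow> ('a \<Rightarrow> 'b::euclidean_space) \<Rightarrow> 'b set \<Rightarrow> real \<Rightarrow> real \<Rightarrow>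
   'a \<Rightarrow> 'b \<Rightarrow> 'a \<Rightarrow> real"
  where "prox_smooth f g K lam c zp pp u =
     lam * AL_smooth f g K c pp u + 1 / 2 * (norm (u - zp))\<^sup>2"

definition prox_curv ::
  "real \<Rightarrow> real \<Rightarrow> ('a::euclidean_space \<Rightarrow> 'b::euclidean_space) \<Rightarrow> 'a set \<Rightarrow> real \<Rightarrow> real \<Rightarrow> 'b \<Rightarrow> real"
  where "prox_curv M L\<^sub>g g Z lam c pp = lam * AL_curv M L\<^sub>g g Z c pp + 1"

definition refined_z ::
  "('a::euclidean_space \<Rightarrow> real) \<Rightarrow> ('a \<Rightarrow> ereal) \<Rightarrow> real \<Rightarrow> 'a \<Rightarrow> 'a"
  where "refined_z F h L z =
     (ARG_MIN (\<lambda>u. ereal (linearization F z u) + h u + ereal (L / 2 * (norm (u - z))\<^sup>2)) u. True)"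

definition refined_v ::
  "('a::euclidean_space \<Rightarrow> real) \<Rightarrow> ('a \<Rightarrow> ereal) \<Rightarrow> real \<Rightarrow> 'a \<Rightarrow> 'a"
  where "refined_v F h L z =
     L *\<^sub>R (z - refined_z F h L z) + grad F (refined_z F h L z) - grad F z"

definition mult_update ::
  "('a::euclidean_space \<Rightarrow> 'b::euclidean_space) \<Rightarrow> 'b set \<Rightarrow> real \<Rightarrow> 'b \<Rightarrow> 'a \<Rightarrow> 'b"
  where "mult_update g K c pp z = closest_point (dual_cone K) (pp + c *\<^sub>R g z)"

definition aipal_stop ::
  "('a::euclidean_space \<Rightarrow> real) \<Rightarrow> ('a \<Rightarrow> ereal) \<Rightarrow> ('a \<Rightarrow> 'b::euclidean_space) \<Rightarrow> 'b set \<Rightarrow>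
   'a set \<Rightarrow> real \<Rightarrow> real \<Rightarrow> real \<Rightarrow> real \<Rightarrow> real \<Rightarrow> real \<Rightarrow> 'b \<Rightarrow> 'a \<Rightarrow> bool"
  where "aipal_stop f h g K Z M L\<^sub>g lam \<rho> \<eta> c pp z \<longleftrightarrow>
     (let F = AL_smooth f g K c pp;
          L = prox_curv M L\<^sub>g g Z lam c pp / lam;
          q = (1 / c) *\<^sub>R (pp - mult_update g K c pp (refined_z F h L z))
      in norm (refined_v F h L z) \<le> \<rho> \<and> norm q \<le> \<eta>)"

text \<open>The sequences \<open>z\<close>, \<open>p\<close>, \<open>c\<close>, \<open>khat\<close> record a run whose iterations \<open>1, \<dots>, n\<close>
  have been performed; \<open>c k\<close> and \<open>khat k\<close> are the values in force when iteration \<open>k\<close> starts.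
  Values at larger indices are irrelevant. The run may or may not stop at iteration \<open>n\<close>.\<close>

definition aipal_run ::
  "('a::euclidean_space \<Rightarrow> real) \<Rightarrow> ('a \<Rightarrow> ereal) \<Rightarrow> ('a \<Rightarrow> 'b::euclidean_space) \<Rightarrow> 'b set \<Rightarrow>
   'a set \<Rightarrow> real \<Rightarrow> real \<Rightarrow> real \<Rightarrow> real \<Rightarrow> real \<Rightarrow> real \<Rightarrow> real \<Rightarrow> real \<Rightarrow> 'a \<Rightarrow> 'b \<Rightarrow>
   nat \<Rightarrow> (nat \<Rightarrow> 'a) \<Rightarrow> (nat \<Rightarrow> 'b) \<Rightarrow> (nat \<Rightarrow> real) \<Rightarrow> (nat \<Rightarrow> nat) \<Rightarrow> bool"
  where "aipal_run f h g K Z m M L\<^sub>g lam \<theta> \<rho> \<eta> c\<^sub>1 z\<^sub>0 p\<^sub>0 n z p c khat \<longleftrightarrow>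
     z 0 = z\<^sub>0 \<and> p 0 = p\<^sub>0 \<and> c 1 = c\<^sub>1 \<and> khat 1 = 0 \<and>
     (\<forall>k\<in>{1..n}.
        (let L = prox_curv M L\<^sub>g g Z lam (c k) (p (k - 1))
         in \<exists>v \<epsilon>. acg3_returns (prox_smooth f g K lam (c k) (z (k - 1)) (p (k - 1)))
                   (\<lambda>u. ereal lam * h u) (z (k - 1)) (1 - lam * m) L (\<theta>\<^sup>2 / L) (z k, v, \<epsilon>)) \<and>
        p k = mult_update g K (c k) (p (k - 1)) (z k)) \<and>
     (\<forall>k\<in>{1..<n}.
        \<not> aipal_stop f h g K Z M L\<^sub>g lam \<rho> \<eta> (c k) (p (k - 1)) (z k) \<and>
        (if k > khat k + 1 \<and>
            (real_of_ereal (AL f h g K (c k) (z (khat k + 1)) (p (khat k + 1))) -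
             real_of_ereal (AL f h g K (c k) (z k) (p k))) / (real k - real (khat k) - 1)
              \<le> lam * (1 - \<theta>) * \<rho>\<^sup>2 / 36
         then c (Suc k) = 2 * c k \<and> khat (Suc k) = k
         else c (Suc k) = c k \<and> khat (Suc k) = khat k))"

text \<open>All points at which \<open>f\<close> is linearised by the inner calls of iterations \<open>1, \<dots>, n\<close>.\<close>

definition aipal_lin_points ::
  "('a::euclidean_space \<Rightarrow> real) \<Rightarrow> ('a \<Rightarrow> ereal) \<Rightarrow> ('a \<Rightarrow> 'b::euclidean_space) \<Rightarrow> 'b set \<Rightarrow>
   'a set \<Rightarrow> real \<Rightarrow> real \<Rightarrow> real \<Rightarrow> real \<Rightarrow> real \<Rightarrow>
   nat \<Rightarrow> (nat \<Rightarrow> 'a) \<Rightarrow> (nat \<Rightarrow> 'b) \<Rightarrow> (nat \<Rightarrow> real) \<Rightarrow> 'a set"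
  where "aipal_lin_points f h g K Z m M L\<^sub>g lam \<theta> n z p c =
     (\<Union>k\<in>{1..n}.
        let L = prox_curv M L\<^sub>g g Z lam (c k) (p (k - 1))
        in acg3_lin_points (prox_smooth f g K lam (c k) (z (k - 1)) (p (k - 1)))
             (\<lambda>u. ereal lam * h u) (z (k - 1)) (1 - lam * m) L (\<theta>\<^sup>2 / L))"

end

theory Submission
  imports Defs
begin

text \<open>The quadratic \<open>\<Gamma>\<close> maintained by the ACG iterations minorises \<open>\<psi>\<close> on \<open>Z\<close>, which makes the
  output \<open>(z, v, \<epsilon>)\<close> satisfy \<open>v \<in> \<partial>\<^sub>\<epsilon> \<psi>(z)\<close>. Testing this inclusion a short step away from \<open>z\<close>
  and bounding the smooth part by its quadratic upper model shows that \<open>z\<close> is approximately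
  stationary, with an error independent of the penalty parameter:
  \<open>\<langle>\<nabla>f(z) + \<nabla>g(z) p, u - z\<rangle> + h(u) - h(z) \<ge> - \<kappa>\<close> for all \<open>u \<in> Z\<close>, where \<open>p\<close> is the updated multiplier.
  Choosing \<open>u\<close> at distance \<open>dist(zbar, \<partial>Z)\<close> from \<open>zbar\<close> in direction \<open>-\<nabla>g(z) p\<close> and using the
  \<open>K\<close>-convexity of \<open>g\<close>, the Slater-type condition, and
  \<open>c \<langle>p, g(z)\<rangle> = \<parallel>p\<parallel>\<^sup>2 - \<langle>p, p\<^sub>p\<^sub>r\<^sub>e\<^sub>v\<rangle>\<close> gives (a); (b) follows from (a) by induction.\<close>

subsection \<open>Projection onto the dual cone\<close>

lemma closed_dual_cone: "closed (dual_cone K)"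
proof -
  have "dual_cone K = (\<Inter>x\<in>K. {p. 0 \<le> x \<bullet> p})"
    by (auto simp: dual_cone_def)
  then show ?thesis
    by (auto intro!: closed_INT closed_Collect_le continuous_intros)
qed

lemma convex_dual_cone: "convex (dual_cone K)"
  by (auto simp: convex_def dual_cone_def inner_right_distrib)

text \<open>This is Moreau's decomposition. The projection \<open>s\<close> of \<open>x\<close> onto
  -\<open>K\<close> leaves a residual \<open>x - s\<close> that is orthogonal to \<open>s\<close>
  and lies in the dual cone, and these two facts identify the residual as the projection onto the
  dual cone.\<close>

lemma Moreau_cone:
  fixes K :: "'b::euclidean_space set"
  assumes K: "closed K" "convex_cone K"
  defines "P \<equiv> \<lambda>x. closest_point (dual_cone K) x"
  shows "P x \<in> dual_cone K" "P x - x \<in> K" "P x \<bullet> (P x - x) = 0"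
    and "infdist x (uminus ` K) = norm (P x)"
proof -
  let ?N = "uminus ` K"
  have cone: "convex K" "K \<noteq> {}" "0 \<in> K" "\<And>x t. x \<in> K \<Longrightarrow> 0 \<le> t \<Longrightarrow> t *\<^sub>R x \<in> K"
    using K(2) by (auto simp: convex_cone_def conic_def convex_cone_contains_0)
  have N: "closed ?N" "convex ?N" "?N \<noteq> {}"
    using K(1) cone by (auto simp: closed_negations convex_negations)
  define s where "s = closest_point ?N x"
  have sN: "s \<in> ?N"
    unfolding s_def using N by (simp add: closest_point_in_set)
  then have sK: "- s \<in> K" by auto
  have opt: "(x - s) \<bullet> (y - s) \<le> 0" if "y \<in> ?N" for y
    unfolding s_def using closest_point_dot[OF N(2,1) that] .
  \<comment> \<open>A cone contains 0 and \<open>2 *\<^sub>R s\<close>; testing the variational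
    inequality at both points bounds \<open>(x - s) \<bullet> s\<close> from both sides by
    0.\<close>
  have "0 \<in> ?N" using cone(3) by force
  from opt[OF this] have a1: "0 \<le> (x - s) \<bullet> s" by simp
  have "2 *\<^sub>R s \<in> ?N" using cone(4)[OF sK, of 2] by (force simp: image_iff)
  from opt[OF this] have a2: "(x - s) \<bullet> s \<le> 0" by (simp add: scaleR_2)
  have ortho: "(x - s) \<bullet> s = 0" using a1 a2 by simp
  have dual: "x - s \<in> dual_cone K"
    unfolding dual_cone_def
  proof safe
    fix y assume "y \<in> K"
    then have "(x - s) \<bullet> (- y - s) \<le> 0" by (intro opt) auto
    then show "0 \<le> y \<bullet> (x - s)"
      using ortho by (simp add: inner_diff_right inner_commute)
  qed
  have "x - s = P x"
    unfolding P_def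
  proof (rule closest_point_unique[OF convex_dual_cone closed_dual_cone dual], safe)
    fix q assume "q \<in> dual_cone K"
    then have "0 \<le> (- s) \<bullet> q" using sK by (auto simp: dual_cone_def)
    then have "s \<bullet> (x - s - q) \<ge> 0"
      using ortho by (simp add: inner_diff_right inner_commute)
    moreover have "(norm (x - q))\<^sup>2 = (norm s)\<^sup>2 + 2 * (s \<bullet> (x - s - q)) + (norm (x - s - q))\<^sup>2"
      by (simp add: power2_norm_eq_inner inner_simps inner_commute)
    ultimately have "(norm s)\<^sup>2 \<le> (norm (x - q))\<^sup>2"
      by (smt (verit) zero_le_power2)
    then show "dist x (x - s) \<le> dist x q"
      by (simp add: dist_norm power2_le_iff_abs_le)
  qed
  then have seq: "s = x - P x" by (metis diff_diff_eq2 add_diff_cancel_left')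
  show "P x \<in> dual_cone K" using dual seq by simp
  show "P x - x \<in> K" using sK seq by simp
  show "P x \<bullet> (P x - x) = 0" using ortho seq by (simp add: inner_diff_right)
  have "infdist x ?N = dist x s"
    using setdist_closest_point[OF N(1,3), of x] s_def
    by (simp add: infdist_eq_setdist)
  then show "infdist x ?N = norm (P x)" using seq by (simp add: dist_norm)
qed

text \<open>The bounds say that half the squared distance to -\<open>K\<close> is convex with a
  1-Lipschitz gradient, the projection onto the dual cone. The lower one pairs
  \<open>?P x' - x'\<close> in \<open>K\<close> with \<open>?P x\<close> in the dual cone; the upper
  one compares with the feasible point \<open>x - ?P x\<close> of -\<open>K\<close>.\<close>

lemma dist_cone_bounds:
  fixes K :: "'b::euclidean_space set"
  assumes K: "closed K" "convex_cone K"
  shows "2 * (closest_point (dual_cone K) x \<bullet> (x' - x))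
      \<le> (infdist x' (uminus ` K))\<^sup>2 - (infdist x (uminus ` K))\<^sup>2" (is ?lower)
    and "(infdist x' (uminus ` K))\<^sup>2 - (infdist x (uminus ` K))\<^sup>2
      \<le> 2 * (closest_point (dual_cone K) x \<bullet> (x' - x)) + (norm (x' - x))\<^sup>2" (is ?upper)
proof -
  note M = Moreau_cone[OF K]
  let ?P = "closest_point (dual_cone K)"
  have "0 \<le> (?P x' - x') \<bullet> ?P x"
    using M(1)[of x] M(2)[of x'] by (auto simp: dual_cone_def)
  moreover have "0 \<le> (norm (?P x' - ?P x))\<^sup>2" by simp
  ultimately show ?lower
    using M(3)[of x] M(3)[of x']
    unfolding M(4) power2_norm_eq_inner by (simp add: inner_simps inner_commute)
  have "infdist x' (uminus ` K) \<le> dist x' (x - ?P x)"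
    by (rule infdist_le) (use M(2)[of x] in \<open>force simp: image_iff\<close>)
  also have "\<dots> = norm (x' - x + ?P x)" by (simp add: dist_norm algebra_simps)
  finally have "(infdist x' (uminus ` K))\<^sup>2 \<le> (norm (x' - x + ?P x))\<^sup>2"
    by (simp add: infdist_nonneg power_mono)
  then show ?upper
    using M(4)[of x] by (simp add: power2_norm_eq_inner inner_simps inner_commute)
qed

lemma norm_closest_point_dual_cone_le: "norm (closest_point (dual_cone K) x) \<le> norm x"
proof -
  have 0: "0 \<in> dual_cone K" by (simp add: dual_cone_def)
  then have "dist (closest_point (dual_cone K) x) (closest_point (dual_cone K) 0) \<le> dist x 0"
    by (intro closest_point_lipschitz convex_dual_cone closed_dual_cone) auto
  then show ?thesis using closest_point_self[OF 0] by simp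
qed

subsection \<open>Gradients\<close>

lemma GDERIV_unique:
  assumes "GDERIV F x :> D" "GDERIV F x :> E"
  shows "D = E"
proof -
  have "(\<lambda>h. h \<bullet> D) = (\<lambda>h. h \<bullet> E)"
    using assms unfolding gderiv_def by (rule has_derivative_unique)
  then show ?thesis by (metis inner_eq_zero_iff inner_diff_right right_minus_eq)
qed

lemma grad_eqI: "GDERIV F x :> D \<Longrightarrow> grad F x = D"
  unfolding grad_def by (blast intro: GDERIV_unique)

lemma GDERIV_grad:
  fixes F :: "'a::euclidean_space \<Rightarrow> real"
  assumes "F differentiable (at x)"
  shows "GDERIV F x :> grad F x"
proof -
  obtain F' where F': "(F has_derivative F') (at x)"
    using assms by (auto simp: differentiable_def)
  then have lin: "linear F'" by (rule has_derivative_linear)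
  \<comment> \<open>The adjoint of a functional, evaluated at 1, is its Riesz representer.\<close>
  have "F' = (\<lambda>v. v \<bullet> adjoint F' 1)"
    using adjoint_works[OF lin, of _ 1] by auto
  with F' have "GDERIV F x :> adjoint F' 1" by (simp add: gderiv_def)
  then show ?thesis using grad_eqI by metis
qed

lemma grad_map_inner:
  fixes g :: "'a::euclidean_space \<Rightarrow> 'b::euclidean_space"
  assumes "g differentiable (at x)"
  shows "blinfun_apply (grad_map g x) p \<bullet> v = p \<bullet> frechet_derivative g (at x) v"
proof -
  have lin: "linear (frechet_derivative g (at x))"
    using assms frechet_derivative_works has_derivative_linear by blast
  \<comment> \<open>\<open>Blinfun\<close> can be evaluated only once its argument is known to be
    bounded linear.\<close>
  then have "bounded_linear (adjoint (frechet_derivative g (at x)))"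
    by (simp add: adjoint_linear linear_conv_bounded_linear[symmetric])
  then show ?thesis
    unfolding grad_map_def
    by (simp add: bounded_linear_Blinfun_apply inner_commute adjoint_works[OF lin])
qed

lemma GDERIV_inner_map:
  fixes g :: "'a::euclidean_space \<Rightarrow> 'b::euclidean_space"
  assumes "g differentiable (at x)"
  shows "GDERIV (\<lambda>u. p \<bullet> g u) x :> blinfun_apply (grad_map g x) p"
proof -
  have "(g has_derivative frechet_derivative g (at x)) (at x)"
    using assms frechet_derivative_works by blast
  then have "((\<lambda>u. p \<bullet> g u) has_derivative (\<lambda>v. p \<bullet> frechet_derivative g (at x) v)) (at x)"
    by (rule has_derivative_inner_right)
  then show ?thesis
    unfolding gderiv_def using grad_map_inner[OF assms, of p] by (simp add: inner_commute)
qed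

lemma GDERIV_along_line:
  assumes "GDERIV F (x + t *\<^sub>R v) :> D"
  shows "((\<lambda>t. F (x + t *\<^sub>R v)) has_real_derivative D \<bullet> v) (at t)"
proof -
  have "((\<lambda>t. x + t *\<^sub>R v) has_derivative (\<lambda>t. t *\<^sub>R v)) (at t)"
    by (auto intro!: derivative_eq_intros)
  moreover have "(F has_derivative (\<lambda>h. h \<bullet> D)) (at (x + t *\<^sub>R v))"
    using assms by (simp add: gderiv_def)
  ultimately have "((\<lambda>t. F (x + t *\<^sub>R v)) has_derivative (\<lambda>t. (t *\<^sub>R v) \<bullet> D)) (at t)"
    using has_derivative_compose by blast
  moreover have "(\<lambda>t. (t *\<^sub>R v) \<bullet> D) = (*) (D \<bullet> v)"
    by (simp add: fun_eq_iff inner_commute)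
  ultimately show ?thesis by (simp add: has_field_derivative_def)
qed

text \<open>Pairing with an element of the dual cone turns \<open>K\<close>-convexity into ordinary
  convexity of a scalar function. The claim is its tangent inequality on the line from
  \<open>x\<close> to \<open>u\<close>, at parameter 0.\<close>

lemma cone_convex_gradient_le:
  fixes g :: "'a::euclidean_space \<Rightarrow> 'b::euclidean_space"
  assumes "g differentiable (at x)" "cone_convex K g" "p \<in> dual_cone K"
  shows "blinfun_apply (grad_map g x) p \<bullet> (u - x) \<le> p \<bullet> g u - p \<bullet> g x"
proof -
  let ?\<phi> = "\<lambda>t::real. p \<bullet> g (x + t *\<^sub>R (u - x))"
  have D: "(?\<phi> has_real_derivative blinfun_apply (grad_map g x) p \<bullet> (u - x)) (at 0)"
    using GDERIV_along_line[of "\<lambda>u. p \<bullet> g u" x 0 "u - x"] GDERIV_inner_map[OF assms(1)] by simp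
  have conv: "convex_on UNIV ?\<phi>"
  proof
    fix t a b :: real assume t: "0 < t" "t < 1"
    let ?a = "x + a *\<^sub>R (u - x)" and ?b = "x + b *\<^sub>R (u - x)"
    have "x + ((1 - t) *\<^sub>R a + t *\<^sub>R b) *\<^sub>R (u - x) = t *\<^sub>R ?b + (1 - t) *\<^sub>R ?a"
      by (simp add: algebra_simps)
    moreover have "t *\<^sub>R g ?b + (1 - t) *\<^sub>R g ?a - g (t *\<^sub>R ?b + (1 - t) *\<^sub>R ?a) \<in> K"
      using assms(2) t by (simp add: cone_convex_def cone_le_def)
    then have "0 \<le> p \<bullet> (t *\<^sub>R g ?b + (1 - t) *\<^sub>R g ?a - g (t *\<^sub>R ?b + (1 - t) *\<^sub>R ?a))"
      using assms(3) by (auto simp: dual_cone_def inner_commute)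
    ultimately show "?\<phi> ((1 - t) *\<^sub>R a + t *\<^sub>R b) \<le> (1 - t) * ?\<phi> a + t * ?\<phi> b"
      by (simp add: inner_diff_right inner_add_right)
  qed simp
  have "(blinfun_apply (grad_map g x) p \<bullet> (u - x)) * (1 - 0) \<le> ?\<phi> 1 - ?\<phi> 0"
    using D by (intro convex_on_imp_above_tangent[OF conv]) auto
  then show ?thesis by simp
qed

text \<open>The mean value theorem is applied to \<open>g\<close> paired with the fixed vector
  \<open>p = g w - g z\<close>. The increment of this pairing is the square of
  \<open>norm p\<close>, and one factor cancels.\<close>

lemma norm_map_diff_le:
  fixes g :: "'a::euclidean_space \<Rightarrow> 'b::euclidean_space"
  assumes g: "\<And>x. g differentiable (at x)"
    and Z: "convex Z" "z \<in> Z" "w \<in> Z" and B: "\<And>x. x \<in> Z \<Longrightarrow> norm (grad_map g x) \<le> B"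
  shows "norm (g w - g z) \<le> B * norm (w - z)"
proof -
  define p where "p = g w - g z"
  have "\<exists>t>0. t < 1 \<and> p \<bullet> g (z + 1 *\<^sub>R (w - z)) - p \<bullet> g (z + 0 *\<^sub>R (w - z))
      = (1 - 0) * (blinfun_apply (grad_map g (z + t *\<^sub>R (w - z))) p \<bullet> (w - z))"
    by (rule MVT2) (auto intro!: GDERIV_along_line GDERIV_inner_map g)
  then obtain t where t: "0 < t" "t < 1"
    "p \<bullet> p = blinfun_apply (grad_map g (z + t *\<^sub>R (w - z))) p \<bullet> (w - z)"
    by (auto simp: p_def inner_diff_right)
  let ?x = "z + t *\<^sub>R (w - z)"
  have "?x = (1 - t) *\<^sub>R z + t *\<^sub>R w" by (simp add: algebra_simps)
  then have xZ: "?x \<in> Z" using Z t by (simp add: convex_def)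
  have "norm p * norm p = p \<bullet> p" by (simp add: power2_norm_eq_inner[symmetric] power2_eq_square)
  also have "\<dots> \<le> norm (blinfun_apply (grad_map g ?x) p) * norm (w - z)"
    unfolding t(3) by (rule norm_cauchy_schwarz)
  also have "\<dots> \<le> (norm (grad_map g ?x) * norm p) * norm (w - z)"
    by (intro mult_right_mono norm_blinfun) auto
  also have "\<dots> \<le> (B * norm p) * norm (w - z)"
    by (intro mult_right_mono B xZ) auto
  finally have "norm p * norm p \<le> norm p * (B * norm (w - z))" by (simp add: mult_ac)
  moreover have "0 \<le> B" using B[OF xZ] norm_ge_zero order_trans by blast
  ultimately show ?thesis
    unfolding p_def[symmetric] by (cases "p = 0") auto
qed

text \<open>Subtracting the quadratic model along the segment leaves a function
  \<open>?\<phi>\<close> whose derivative is nonpositive on [0, 1] by the Lipschitz bound, so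
  \<open>?\<phi> 1 \<le> ?\<phi> 0\<close>.\<close>

lemma inner_map_descent:
  fixes g :: "'a::euclidean_space \<Rightarrow> 'b::euclidean_space"
  assumes g: "\<And>x. g differentiable (at x)"
    and L: "\<And>u z. norm (grad_map g u - grad_map g z) \<le> L * norm (u - z)"
  shows "p \<bullet> g w - p \<bullet> g z
    \<le> blinfun_apply (grad_map g z) p \<bullet> (w - z) + norm p * L / 2 * (norm (w - z))\<^sup>2"
proof -
  let ?D = "\<lambda>t. blinfun_apply (grad_map g (z + t *\<^sub>R (w - z))) p \<bullet> (w - z)"
  let ?\<phi> = "\<lambda>t. p \<bullet> g (z + t *\<^sub>R (w - z)) - t * ?D 0 - norm p * L / 2 * (norm (w - z))\<^sup>2 * t\<^sup>2"
  have "?\<phi> 1 \<le> ?\<phi> 0"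
  proof (rule DERIV_nonpos_imp_nonincreasing[where f = ?\<phi>])
    fix t :: real assume t: "0 \<le> t" "t \<le> 1"
    let ?x = "z + t *\<^sub>R (w - z)"
    have "?D t - ?D 0 = blinfun_apply (grad_map g ?x - grad_map g z) p \<bullet> (w - z)"
      by (simp add: blinfun.diff_left inner_diff_left)
    also have "\<dots> \<le> norm (blinfun_apply (grad_map g ?x - grad_map g z) p) * norm (w - z)"
      by (rule norm_cauchy_schwarz)
    also have "\<dots> \<le> (norm (grad_map g ?x - grad_map g z) * norm p) * norm (w - z)"
      by (intro mult_right_mono norm_blinfun) auto
    also have "\<dots> \<le> ((L * norm (?x - z)) * norm p) * norm (w - z)"
      by (intro mult_right_mono L) auto
    also have "\<dots> = norm p * L * (norm (w - z))\<^sup>2 * t"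
      using t by (simp add: power2_eq_square)
    finally have le: "?D t - ?D 0 - norm p * L / 2 * (norm (w - z))\<^sup>2 * (2 * t) \<le> 0" by simp
    have "((\<lambda>t. p \<bullet> g (z + t *\<^sub>R (w - z))) has_real_derivative ?D t) (at t)"
      by (intro GDERIV_along_line GDERIV_inner_map g)
    then have "(?\<phi> has_real_derivative
        ?D t - ?D 0 - norm p * L / 2 * (norm (w - z))\<^sup>2 * (2 * t)) (at t)"
      by (auto intro!: derivative_eq_intros)
    then show "\<exists>y. (?\<phi> has_real_derivative y) (at t) \<and> y \<le> 0" using le by blast
  qed simp
  then show ?thesis by simp
qed

subsection \<open>The augmented Lagrangian\<close>

text \<open>The bounds of \<open>dist_cone_bounds\<close> sandwich the first-order remainder between
  0 and the squared increment.\<close>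

lemma GDERIV_dist_cone_sq:
  fixes K :: "'b::euclidean_space set"
  assumes K: "closed K" "convex_cone K"
  shows "GDERIV (\<lambda>y. (infdist y (uminus ` K))\<^sup>2) x :> 2 *\<^sub>R closest_point (dual_cone K) x"
  unfolding gderiv_def
proof (rule has_derivativeI_sandwich[of 1])
  let ?D = "\<lambda>y. (infdist y (uminus ` K))\<^sup>2"
  show "bounded_linear (\<lambda>h. h \<bullet> (2 *\<^sub>R closest_point (dual_cone K) x))"
    by (rule bounded_linear_inner_left)
  show "((\<lambda>y. norm (y - x)) \<longlongrightarrow> 0) (at x)"
    by (auto intro!: tendsto_eq_intros)
  fix y assume "y \<noteq> x"
  have "\<bar>?D y - ?D x - (y - x) \<bullet> (2 *\<^sub>R closest_point (dual_cone K) x)\<bar> \<le> (norm (y - x))\<^sup>2"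
    using dist_cone_bounds(1)[OF K, where x = x and x' = y] dist_cone_bounds(2)[OF K, where x = x and x' = y]
    by (simp add: inner_commute)
  then show "norm (?D y - ?D x - (y - x) \<bullet> (2 *\<^sub>R closest_point (dual_cone K) x)) / norm (y - x)
      \<le> norm (y - x)"
    using \<open>y \<noteq> x\<close> by (simp add: divide_simps power2_eq_square)
qed simp

text \<open>The chain rule produces the factors \<open>c\<close> and 2, which cancel
  \<open>1 / (2 * c)\<close>. What remains is the gradient of the ordinary Lagrangian at the updated
  multiplier, which links the subproblem to the multiplier sequence.\<close>

lemma GDERIV_AL_smooth:
  fixes g :: "'a::euclidean_space \<Rightarrow> 'b::euclidean_space"
  assumes K: "closed K" "convex_cone K" and c: "0 < c"
    and f: "f differentiable (at x)" and g: "g differentiable (at x)"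
  shows "GDERIV (AL_smooth f g K c p) x :>
    grad f x + blinfun_apply (grad_map g x) (mult_update g K c p x)"
proof -
  let ?P = "mult_update g K c p x" and ?g' = "frechet_derivative g (at x)"
  let ?D = "\<lambda>u. (infdist (p + c *\<^sub>R g u) (uminus ` K))\<^sup>2"
  have "(g has_derivative ?g') (at x)"
    using g frechet_derivative_works by blast
  then have "((\<lambda>u. p + c *\<^sub>R g u) has_derivative (\<lambda>v. c *\<^sub>R ?g' v)) (at x)"
    by (auto intro!: derivative_eq_intros)
  then have D: "(?D has_derivative (\<lambda>v. (c *\<^sub>R ?g' v) \<bullet> (2 *\<^sub>R ?P))) (at x)"
    using GDERIV_dist_cone_sq[OF K, of "p + c *\<^sub>R g x"] has_derivative_compose
    unfolding gderiv_def mult_update_def by blast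
  have f': "(f has_derivative (\<lambda>v. v \<bullet> grad f x)) (at x)"
    using GDERIV_grad[OF f] by (simp add: gderiv_def)
  have "((\<lambda>u. f u + 1 / (2 * c) * (?D u - (norm p)\<^sup>2)) has_derivative
      (\<lambda>v. v \<bullet> grad f x + 1 / (2 * c) * ((c *\<^sub>R ?g' v) \<bullet> (2 *\<^sub>R ?P)))) (at x)"
    by (rule derivative_eq_intros f' D | simp)+
  moreover have "v \<bullet> grad f x + 1 / (2 * c) * ((c *\<^sub>R ?g' v) \<bullet> (2 *\<^sub>R ?P))
      = v \<bullet> (grad f x + blinfun_apply (grad_map g x) ?P)" for v
    using c grad_map_inner[OF g, of ?P v] by (simp add: inner_add_right inner_commute)
  ultimately show ?thesis
    unfolding gderiv_def AL_smooth_def[abs_def] by simp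
qed

text \<open>The penalty term lies above its tangent, because the updated multiplier is in the dual
  cone and \<open>g\<close> is \<open>K\<close>-convex; hence only \<open>f\<close> contributes
  negative curvature. All hypotheses are pointwise at \<open>x\<close>, so the bound also serves
  extrapolated points outside \<open>Z\<close>.\<close>

lemma AL_smooth_lower:
  fixes g :: "'a::euclidean_space \<Rightarrow> 'b::euclidean_space"
  assumes K: "closed K" "convex_cone K" and c: "0 < c"
    and f: "f differentiable (at x)" and g: "g differentiable (at x)" "cone_convex K g"
    and low: "- (m / 2) * (norm (u - x))\<^sup>2 \<le> f u - linearization f x u"
  fixes p
  defines "F \<equiv> AL_smooth f g K c p"
  shows "- (m / 2) * (norm (u - x))\<^sup>2 \<le> F u - linearization F x u"
proof -
  let ?P = "mult_update g K c p x"
  let ?D = "\<lambda>u. (infdist (p + c *\<^sub>R g u) (uminus ` K))\<^sup>2"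
  have gF: "grad F x = grad f x + blinfun_apply (grad_map g x) ?P"
    unfolding F_def by (intro grad_eqI GDERIV_AL_smooth K c f g)
  have P: "?P \<in> dual_cone K"
    unfolding mult_update_def by (rule Moreau_cone(1)[OF K])
  have diff: "(p + c *\<^sub>R g u) - (p + c *\<^sub>R g x) = c *\<^sub>R (g u - g x)"
    by (simp add: scaleR_diff_right)
  have "2 * (c * (?P \<bullet> (g u - g x))) \<le> ?D u - ?D x"
    using dist_cone_bounds(1)[OF K, of "p + c *\<^sub>R g x" "p + c *\<^sub>R g u"]
    unfolding diff mult_update_def[symmetric] inner_scaleR_right .
  then have "?P \<bullet> (g u - g x) \<le> 1 / (2 * c) * (?D u - ?D x)"
    using c by (simp add: field_simps)
  moreover have "blinfun_apply (grad_map g x) ?P \<bullet> (u - x) \<le> ?P \<bullet> (g u - g x)"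
    using cone_convex_gradient_le[OF g P] by (simp add: inner_diff_right)
  moreover have "F u - F x = f u - f x + 1 / (2 * c) * (?D u - ?D x)"
    unfolding F_def AL_smooth_def by (simp add: algebra_simps)
  ultimately show ?thesis
    using low unfolding linearization_def gF inner_add_left by linarith
qed

text \<open>The curvature has three sources: \<open>M\<close> from \<open>f\<close>, the curvature
  of \<open>g\<close> weighted by the multiplier norm, which is at most
  \<open>norm p + c * B0\<close>, and \<open>c * B1\<^sup>2\<close> from the quadratic remainder of
  the squared distance. Their sum has the form of \<open>AL_curv\<close>.\<close>

lemma AL_smooth_upper:
  fixes g :: "'a::euclidean_space \<Rightarrow> 'b::euclidean_space"
  assumes K: "closed K" "convex_cone K" and c: "0 < c"
    and g: "\<And>x. g differentiable (at x)"
    and L: "\<And>u z. norm (grad_map g u - grad_map g z) \<le> L * norm (u - z)" "0 \<le> L"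
    and Z: "convex Z" "z \<in> Z" "w \<in> Z"
    and B0: "norm (g z) \<le> B0" and B1: "\<And>x. x \<in> Z \<Longrightarrow> norm (grad_map g x) \<le> B1"
    and up: "f w - linearization f z w \<le> M / 2 * (norm (w - z))\<^sup>2"
  fixes p
  defines "F \<equiv> AL_smooth f g K c p"
  shows "F w - F z \<le> (grad f z + blinfun_apply (grad_map g z) (mult_update g K c p z)) \<bullet> (w - z)
    + (M + L * norm p + c * (B0 * L + B1\<^sup>2)) / 2 * (norm (w - z))\<^sup>2"
proof -
  let ?P = "mult_update g K c p z"
  let ?D = "\<lambda>u. (infdist (p + c *\<^sub>R g u) (uminus ` K))\<^sup>2"
  let ?n = "(norm (w - z))\<^sup>2"
  have diff: "(p + c *\<^sub>R g w) - (p + c *\<^sub>R g z) = c *\<^sub>R (g w - g z)"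
    by (simp add: scaleR_diff_right)
  have "?D w - ?D z \<le> 2 * (c * (?P \<bullet> (g w - g z))) + (norm (c *\<^sub>R (g w - g z)))\<^sup>2"
    using dist_cone_bounds(2)[OF K, where x = "p + c *\<^sub>R g z" and x' = "p + c *\<^sub>R g w"]
    unfolding diff mult_update_def[symmetric] inner_scaleR_right .
  then have "1 / (2 * c) * (?D w - ?D z)
      \<le> 1 / (2 * c) * (2 * c * (?P \<bullet> (g w - g z)) + c\<^sup>2 * (norm (g w - g z))\<^sup>2)"
    using c by (intro mult_left_mono) (simp_all add: power_mult_distrib)
  also have "\<dots> = ?P \<bullet> (g w - g z) + c / 2 * (norm (g w - g z))\<^sup>2"
    using c by (simp add: field_simps power2_eq_square)
  finally have D: "1 / (2 * c) * (?D w - ?D z) \<le> ?P \<bullet> g w - ?P \<bullet> g z + c / 2 * (norm (g w - g z))\<^sup>2"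
    by (simp add: inner_diff_right)
  have "norm (g w - g z) \<le> B1 * norm (w - z)"
    by (rule norm_map_diff_le[OF g Z B1])
  then have "(norm (g w - g z))\<^sup>2 \<le> (B1 * norm (w - z))\<^sup>2"
    by (intro power_mono) auto
  then have "c / 2 * (norm (g w - g z))\<^sup>2 \<le> c / 2 * (B1 * norm (w - z))\<^sup>2"
    using c by (intro mult_left_mono) auto
  then have 1: "c / 2 * (norm (g w - g z))\<^sup>2 \<le> c * B1\<^sup>2 / 2 * ?n"
    by (simp add: power_mult_distrib)
  have "norm ?P \<le> norm (p + c *\<^sub>R g z)"
    unfolding mult_update_def by (rule norm_closest_point_dual_cone_le)
  also have "\<dots> \<le> norm p + c * norm (g z)"
    using c norm_triangle_ineq[of p "c *\<^sub>R g z"] by simp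
  also have "\<dots> \<le> norm p + c * B0"
    using B0 c by simp
  finally have "norm ?P * L / 2 * ?n \<le> (norm p + c * B0) * L / 2 * ?n"
    using L(2) by (intro mult_right_mono divide_right_mono) auto
  then have 2: "?P \<bullet> g w - ?P \<bullet> g z
      \<le> blinfun_apply (grad_map g z) ?P \<bullet> (w - z) + (norm p + c * B0) * L / 2 * ?n"
    using inner_map_descent[OF g L(1), of ?P w z] by linarith
  have "F w - F z = f w - f z + 1 / (2 * c) * (?D w - ?D z)"
    unfolding F_def AL_smooth_def by (simp add: algebra_simps)
  also have "\<dots> \<le> (grad f z \<bullet> (w - z) + M / 2 * ?n)
      + ((blinfun_apply (grad_map g z) ?P \<bullet> (w - z) + (norm p + c * B0) * L / 2 * ?n)
        + c * B1\<^sup>2 / 2 * ?n)"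
    using up D 1 2 unfolding linearization_def by linarith
  also have "\<dots> = (grad f z + blinfun_apply (grad_map g z) ?P) \<bullet> (w - z)
      + (M + L * norm p + c * (B0 * L + B1\<^sup>2)) / 2 * ?n"
    by (simp add: inner_add_left field_simps)
  finally show ?thesis .
qed

text \<open>The proximal term adds curvature 1 and the scaled Lagrangian loses at most
  \<open>lam * m\<close>; the difference is the modulus passed to the inner solver.\<close>

lemma prox_smooth_lower:
  fixes g :: "'a::euclidean_space \<Rightarrow> 'b::euclidean_space"
  assumes K: "closed K" "convex_cone K" and c: "0 < c" and lam: "0 \<le> lam"
    and f: "f differentiable (at x)" and g: "g differentiable (at x)" "cone_convex K g"
    and low: "- (m / 2) * (norm (u - x))\<^sup>2 \<le> f u - linearization f x u"
  fixes zp p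
  defines "\<psi> \<equiv> prox_smooth f g K lam c zp p"
  shows "linearization \<psi> x u + (1 - lam * m) / 2 * (norm (u - x))\<^sup>2 \<le> \<psi> u"
proof -
  let ?F = "AL_smooth f g K c p"
  have F': "(?F has_derivative (\<lambda>v. v \<bullet> grad ?F x)) (at x)"
    using GDERIV_AL_smooth[OF K c f g(1), of p] grad_eqI unfolding gderiv_def by metis
  have "((\<lambda>u. lam * ?F u + 1 / 2 * ((u - zp) \<bullet> (u - zp))) has_derivative
      (\<lambda>v. v \<bullet> (lam *\<^sub>R grad ?F x + (x - zp)))) (at x)"
    by (rule derivative_eq_intros F' refl)+ (simp add: algebra_simps inner_simps inner_commute)
  then have "GDERIV \<psi> x :> lam *\<^sub>R grad ?F x + (x - zp)"
    unfolding gderiv_def \<psi>_def prox_smooth_def[abs_def] by (simp add: power2_norm_eq_inner)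
  then have g\<psi>: "grad \<psi> x = lam *\<^sub>R grad ?F x + (x - zp)"
    by (rule grad_eqI)
  have "lam * (- (m / 2) * (norm (u - x))\<^sup>2) \<le> lam * (?F u - linearization ?F x u)"
    by (intro mult_left_mono AL_smooth_lower K c f g low lam)
  then have "lam * ?F x + lam * (grad ?F x \<bullet> (u - x)) - lam * m / 2 * (norm (u - x))\<^sup>2 \<le> lam * ?F u"
    unfolding linearization_def by (simp add: algebra_simps)
  moreover have "(1 - lam * m) / 2 * (norm (u - x))\<^sup>2
      = 1 / 2 * (norm (u - x))\<^sup>2 - lam * m / 2 * (norm (u - x))\<^sup>2"
    by (simp add: field_simps)
  moreover have "1 / 2 * (norm (u - zp))\<^sup>2
      = 1 / 2 * (norm (x - zp))\<^sup>2 + (x - zp) \<bullet> (u - x) + 1 / 2 * (norm (u - x))\<^sup>2"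
    by (simp add: power2_norm_eq_inner inner_simps inner_commute field_simps)
  ultimately show ?thesis
    unfolding linearization_def g\<psi> unfolding \<psi>_def prox_smooth_def inner_add_left inner_scaleR_left
    by linarith
qed

subsection \<open>The accelerated composite gradient iterations\<close>

lemma nonneg_linear_term_if_perturbed_nonneg:
  fixes a b :: real
  assumes "\<And>t. 0 < t \<Longrightarrow> t \<le> 1 \<Longrightarrow> 0 \<le> t * a + t\<^sup>2 * b"
  shows "0 \<le> a"
proof (rule ccontr)
  assume "\<not> 0 \<le> a"
  then have a: "a < 0" by simp
  \<comment> \<open>This \<open>t\<close> is small enough that \<open>t * b < - a\<close>, so the
    quadratic term cannot compensate the negative linear one; the added 1 avoids division by
    zero.\<close>
  define t where "t = min 1 (- a / (2 * (\<bar>b\<bar> + 1)))"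
  have t: "0 < t" "t \<le> 1" using a by (auto simp: t_def divide_neg_pos)
  have "t \<le> - a / (2 * (\<bar>b\<bar> + 1))" unfolding t_def by simp
  then have "t * (2 * (\<bar>b\<bar> + 1)) \<le> - a" by (subst (asm) pos_le_divide_eq) auto
  then have "t * b < - a"
    using t by (smt (verit, best) a abs_ge_self mult_left_mono distrib_left mult.left_commute mult_pos_pos)
  have "0 \<le> t * (a + t * b)"
    using assms[OF t] by (simp add: power2_eq_square algebra_simps)
  then have "0 \<le> a + t * b" using t by (simp add: zero_le_mult_iff)
  with \<open>t * b < - a\<close> show False by simp
qed

text \<open>The last claim places the quadratic \<gamma> of an ACG step below the model
  \<open>q\<close> on \<open>Z\<close>. It is the first-order optimality condition of the proximal
  subproblem, rewritten by expanding the squared norms around \<open>y\<close>.\<close>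

lemma composite_prox_step:
  assumes Z: "compact Z" "Z \<noteq> {}"
    and \<psi>n: "\<And>u. u \<in> Z \<Longrightarrow> \<psi>n u = ereal (hn u)" "\<And>u. u \<notin> Z \<Longrightarrow> \<psi>n u = \<infinity>"
    and hn: "convex_on Z hn" "continuous_on Z hn"
    and L: "0 < L"
    and l: "\<And>u. l u = l0 + d \<bullet> (u - x)"
    and q: "\<And>u. q u = ereal (l u) + \<psi>n u + ereal (\<mu> / 2 * (norm (u - x))\<^sup>2)"
    and y: "y = (ARG_MIN (\<lambda>u. ereal (1 / L) * q u + ereal (1 / 2 * (norm (u - x))\<^sup>2)) u. True)"
  shows "y \<in> Z"
    and "real_of_ereal (q y) = l y + hn y + \<mu> / 2 * (norm (y - x))\<^sup>2"
    and "\<And>u. u \<in> Z \<Longrightarrow>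
      real_of_ereal (q y) + L * ((x - y) \<bullet> (u - y)) + \<mu> / 2 * (norm (u - y))\<^sup>2
        \<le> l u + hn u + \<mu> / 2 * (norm (u - x))\<^sup>2"
proof -
  let ?Q = "\<lambda>u. ereal (1 / L) * q u + ereal (1 / 2 * (norm (u - x))\<^sup>2)"
  let ?r = "\<lambda>u. 1 / L * (l u + hn u + \<mu> / 2 * (norm (u - x))\<^sup>2) + 1 / 2 * (norm (u - x))\<^sup>2"
  have Lr: "L * ?r u = l u + hn u + (\<mu> + L) / 2 * (norm (u - x))\<^sup>2" for u
    using L by (simp add: field_simps)
  have Qin: "?Q u = ereal (?r u)" if "u \<in> Z" for u
    using that by (simp add: q \<psi>n)
  have Qout: "?Q u = \<infinity>" if "u \<notin> Z" for u
    using that L by (simp add: q \<psi>n)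
  have "continuous_on Z ?r"
    unfolding l by (intro continuous_intros hn)
  then obtain y0 where y0: "y0 \<in> Z" "\<And>u. u \<in> Z \<Longrightarrow> ?r y0 \<le> ?r u"
    using continuous_attains_inf[OF Z] by blast
  have "?Q y0 \<le> ?Q u" for u
  proof (cases "u \<in> Z")
    case True
    then show ?thesis using y0 by (simp only: Qin ereal_less_eq)
  next
    case False
    show ?thesis by (simp only: Qout[OF False] ereal_less_eq)
  qed
  \<comment> \<open>Attainment on the compact set \<open>Z\<close> ensures that
    \<open>ARG_MIN\<close> selects a genuine minimiser.\<close>
  then have "is_arg_min ?Q (\<lambda>_. True) y0"
    by (simp add: is_arg_min_linorder)
  then have y_min: "?Q y \<le> ?Q u" for u
    unfolding y arg_min_def by (rule someI2) (simp add: is_arg_min_linorder)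
  show yZ: "y \<in> Z"
    using y_min[of y0] Qout[of y] unfolding Qin[OF y0(1)] by (metis PInfty_neq_ereal(1) ereal_infty_less_eq(1))
  show qy: "real_of_ereal (q y) = l y + hn y + \<mu> / 2 * (norm (y - x))\<^sup>2"
    using yZ by (simp add: q \<psi>n)
  fix u assume u: "u \<in> Z"
  \<comment> \<open>This is the variational inequality at \<open>y\<close>: the minimiser is
    compared with the points \<open>(1 - t) *\<^sub>R y + t *\<^sub>R u\<close>, and the term of
    order \<open>t\<^sup>2\<close> is discarded.\<close>
  have "0 \<le> (l u + hn u - l y - hn y) + (\<mu> + L) * ((y - x) \<bullet> (u - y))"
  proof (rule nonneg_linear_term_if_perturbed_nonneg[where b = "(\<mu> + L) / 2 * (norm (u - y))\<^sup>2"])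
    fix t :: real assume t: "0 < t" "t \<le> 1"
    let ?w = "(1 - t) *\<^sub>R y + t *\<^sub>R u"
    have wZ: "?w \<in> Z"
      using hn(1) yZ u t by (simp add: convex_on_def convex_def)
    have hw: "hn ?w \<le> (1 - t) * hn y + t * hn u"
      using convex_onD[OF hn(1)] t yZ u by simp
    have lw: "l ?w = l y + t * (l u - l y)"
      unfolding l by (simp add: inner_simps algebra_simps)
    have nw: "(norm (?w - x))\<^sup>2 = (norm (y - x))\<^sup>2 + 2 * t * ((y - x) \<bullet> (u - y)) + t\<^sup>2 * (norm (u - y))\<^sup>2"
    proof -
      have eq: "?w - x = (y - x) + t *\<^sub>R (u - y)" by (simp add: algebra_simps)
      show ?thesis
        unfolding eq power2_norm_eq_inner by (simp add: inner_add_left inner_add_right inner_commute power2_eq_square algebra_simps)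
    qed
    have "L * ?r y \<le> L * ?r ?w"
      using y_min[of ?w] Qin[OF yZ] Qin[OF wZ] L by (intro mult_left_mono) auto
    then have opt: "l y + hn y + (\<mu> + L) / 2 * (norm (y - x))\<^sup>2
        \<le> l ?w + hn ?w + (\<mu> + L) / 2 * (norm (?w - x))\<^sup>2"
      unfolding Lr .
    have "l y + hn y + (\<mu> + L) / 2 * (norm (y - x))\<^sup>2
        \<le> l y + t * (l u - l y) + ((1 - t) * hn y + t * hn u)
          + (\<mu> + L) / 2 * ((norm (y - x))\<^sup>2 + 2 * t * ((y - x) \<bullet> (u - y)) + t\<^sup>2 * (norm (u - y))\<^sup>2)"
      using opt hw unfolding lw nw by linarith
    then show "0 \<le> t * ((l u + hn u - l y - hn y) + (\<mu> + L) * ((y - x) \<bullet> (u - y)))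
        + t\<^sup>2 * ((\<mu> + L) / 2 * (norm (u - y))\<^sup>2)"
      by (simp add: field_simps)
  qed
  moreover have "(\<mu> + L) * ((y - x) \<bullet> (u - y)) = \<mu> * ((y - x) \<bullet> (u - y)) + L * ((y - x) \<bullet> (u - y))"
    by (rule distrib_right)
  moreover have "L * ((x - y) \<bullet> (u - y)) = - (L * ((y - x) \<bullet> (u - y)))"
    by (metis inner_minus_left minus_diff_eq mult_minus_right)
  moreover have "(norm (u - x))\<^sup>2 = (norm (y - x))\<^sup>2 + 2 * ((y - x) \<bullet> (u - y)) + (norm (u - y))\<^sup>2"
    by (simp add: power2_norm_eq_inner inner_simps inner_commute)
  then have "\<mu> / 2 * (norm (u - x))\<^sup>2 =
      \<mu> / 2 * (norm (y - x))\<^sup>2 + \<mu> * ((y - x) \<bullet> (u - y)) + \<mu> / 2 * (norm (u - y))\<^sup>2"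
    by (simp add: distrib_left)
  ultimately show "real_of_ereal (q y) + L * ((x - y) \<bullet> (u - y)) + \<mu> / 2 * (norm (u - y))\<^sup>2
      \<le> l u + hn u + \<mu> / 2 * (norm (u - x))\<^sup>2"
    unfolding qy by linarith
qed

text \<open>\<open>x\<close> minimises \<open>A \<Gamma> + \<parallel>\<cdot> - y\<^sub>0\<parallel>\<^sup>2 / 2\<close>, so the quadratic \<open>\<Gamma>\<close> has slope \<open>(y\<^sub>0 - x) / A\<close> at \<open>x\<close>.
  The identities are multiplied by \<open>A\<close> to include the initial state \<open>A = 0\<close>.\<close>

definition acg_invariant :: "'a::euclidean_space set \<Rightarrow> ('a \<Rightarrow> real) \<Rightarrow> 'a \<Rightarrow> real \<Rightarrow> 'a acg_state \<Rightarrow> bool"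
  where "acg_invariant Z \<psi> y0 \<mu> s \<longleftrightarrow> (case s of (A, x, y, \<Gamma>) \<Rightarrow>
     0 \<le> A \<and>
     (\<forall>u. A * \<Gamma> u = A * \<Gamma> x + (y0 - x) \<bullet> (u - x) + A * \<mu> / 2 * (norm (u - x))\<^sup>2) \<and>
     (\<forall>u\<in>Z. A * \<Gamma> u \<le> A * \<psi> u))"

text \<open>Scaled by \<open>A'\<close>, the new minorant is
  \<open>A * \<Gamma> u + a * \<gamma> u\<close>, a sum of quadratics whose moduli add up to
  \<open>A' * \<mu>\<close>. It stays below \<psi> on \<open>Z\<close> because \<gamma> lies below
  the linearised model, which \<open>low\<close> places below \<psi>.\<close>

lemma acg_invariant_step:
  fixes \<psi>s :: "'a::euclidean_space \<Rightarrow> real"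
  assumes Z: "compact Z" "Z \<noteq> {}"
    and \<psi>n: "\<And>u. u \<in> Z \<Longrightarrow> \<psi>n u = ereal (hn u)" "\<And>u. u \<notin> Z \<Longrightarrow> \<psi>n u = \<infinity>"
    and hn: "convex_on Z hn" "continuous_on Z hn"
    and L: "0 < L" and \<mu>: "0 \<le> \<mu>"
    and inv: "acg_invariant Z (\<lambda>u. \<psi>s u + hn u) y0 \<mu> s"
    and low: "\<And>u. u \<in> Z \<Longrightarrow> linearization \<psi>s (acg_extrap \<mu> L s) u
      + \<mu> / 2 * (norm (u - acg_extrap \<mu> L s))\<^sup>2 \<le> \<psi>s u"
    and step: "acg_step \<psi>s \<psi>n \<mu> L s = (A', x', y', \<Gamma>')"
  shows "acg_invariant Z (\<lambda>u. \<psi>s u + hn u) y0 \<mu> (A', x', y', \<Gamma>') \<and> 0 < A' \<and> y' \<in> Z"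
proof -
  obtain A x y \<Gamma> where s: "s = (A, x, y, \<Gamma>)" by (cases s) auto
  have A: "0 \<le> A"
    and \<Gamma>: "\<And>u. A * \<Gamma> u = A * \<Gamma> x + (y0 - x) \<bullet> (u - x) + A * \<mu> / 2 * (norm (u - x))\<^sup>2"
    and \<Gamma>_le: "\<And>u. u \<in> Z \<Longrightarrow> A * \<Gamma> u \<le> A * (\<psi>s u + hn u)"
    using inv unfolding acg_invariant_def s prod.case by blast+
  define a where "a = acg_a \<mu> L s"
  define xt where "xt = acg_extrap \<mu> L s"
  define q where "q = (\<lambda>u. ereal (linearization \<psi>s xt u) + \<psi>n u + ereal (\<mu> / 2 * (norm (u - xt))\<^sup>2))"
  define ym where "ym = (ARG_MIN (\<lambda>u. ereal (1 / L) * q u + ereal (1 / 2 * (norm (u - xt))\<^sup>2)) u. True)"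
  define \<gamma> where "\<gamma> = (\<lambda>u. real_of_ereal (q ym) + L * ((xt - ym) \<bullet> (u - ym)) + \<mu> / 2 * (norm (u - ym))\<^sup>2)"
  have "acg_step \<psi>s \<psi>n \<mu> L s = (A + a,
      x + (a / (1 + \<mu> * (A + a))) *\<^sub>R (L *\<^sub>R (ym - xt) + \<mu> *\<^sub>R (ym - x)), ym,
      \<lambda>u. A / (A + a) * \<Gamma> u + a / (A + a) * \<gamma> u)"
    by (simp only: acg_step_def s prod.case Let_def a_def xt_def q_def ym_def \<gamma>_def)
  then have A': "A' = A + a"
    and x': "x' = x + (a / (1 + \<mu> * A')) *\<^sub>R (L *\<^sub>R (y' - xt) + \<mu> *\<^sub>R (y' - x))"
    and \<Gamma>': "\<Gamma>' = (\<lambda>u. A / A' * \<Gamma> u + a / A' * \<gamma> u)"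
    and y': "ym = y'"
    unfolding step by simp_all
  define \<tau> where "\<tau> = (1 + \<mu> * A) / L"
  \<comment> \<open>Positivity of \<tau> makes \<open>a\<close> positive even at the initial value
    \<open>A = 0\<close>, so \<open>A'\<close> may be divided by.\<close>
  have "0 < \<tau>" unfolding \<tau>_def using A \<mu> L by (simp add: add_pos_nonneg)
  moreover have "a = (\<tau> + sqrt (\<tau>\<^sup>2 + 4 * \<tau> * A)) / 2"
    unfolding a_def acg_a_def s \<tau>_def by (simp add: Let_def)
  moreover have "0 \<le> sqrt (\<tau>\<^sup>2 + 4 * \<tau> * A)"
    using A \<open>0 < \<tau>\<close> by simp
  ultimately have a: "0 < a" by (metis add_pos_nonneg half_gt_zero)
  then have A'pos: "0 < A'" using A A' by simp
  have A'\<Gamma>': "A' * \<Gamma>' u = A * \<Gamma> u + a * \<gamma> u" for u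
    using A'pos by (simp add: \<Gamma>' field_simps)
  note prox = composite_prox_step[OF Z \<psi>n hn L linearization_def fun_cong[OF q_def] ym_def, unfolded y']
  have y'Z: "y' \<in> Z" by (rule prox(1))
  have \<gamma>_le: "\<gamma> u \<le> \<psi>s u + hn u" if "u \<in> Z" for u
  proof -
    have "\<gamma> u \<le> linearization \<psi>s xt u + hn u + \<mu> / 2 * (norm (u - xt))\<^sup>2"
      unfolding \<gamma>_def y' by (rule prox(3)) (use that in auto)
    then show ?thesis using low[OF that] unfolding xt_def by linarith
  qed
  \<comment> \<open>The left-hand side is the gradient of
    \<open>A * \<Gamma> u + a * \<gamma> u\<close> at \<open>u = x'\<close>. The update rule for
    \<open>x'\<close> is precisely the condition that it equals \<open>y0 - x'\<close>.\<close>
  have stat: "(y0 - x) + (A * \<mu>) *\<^sub>R (x' - x) + (a * L) *\<^sub>R (xt - y') + (a * \<mu>) *\<^sub>R (x' - y') = y0 - x'"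
  proof -
    have "1 + \<mu> * A' > 0" using \<mu> A'pos by (simp add: add_pos_nonneg)
    then have "(1 + \<mu> * A') *\<^sub>R (x' - x) = a *\<^sub>R (L *\<^sub>R (y' - xt) + \<mu> *\<^sub>R (y' - x))"
      by (simp add: x')
    then show ?thesis by (simp add: A' algebra_simps)
  qed
  have "A' * \<Gamma>' u = A' * \<Gamma>' x' + (y0 - x') \<bullet> (u - x') + A' * \<mu> / 2 * (norm (u - x'))\<^sup>2" for u
  proof -
    have sq: "(norm (u - e))\<^sup>2 - (norm (x' - e))\<^sup>2 = (norm (u - x'))\<^sup>2 + 2 * ((x' - e) \<bullet> (u - x'))" for e
      by (simp add: power2_norm_eq_inner inner_simps inner_commute)
    have "A' * \<Gamma>' u - A' * \<Gamma>' x' = (A * \<Gamma> u - A * \<Gamma> x') + a * (\<gamma> u - \<gamma> x')"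
      unfolding A'\<Gamma>' by (simp add: algebra_simps)
    also have "A * \<Gamma> u - A * \<Gamma> x' = (y0 - x) \<bullet> (u - x') + A * \<mu> / 2 * ((norm (u - x))\<^sup>2 - (norm (x' - x))\<^sup>2)"
      unfolding \<Gamma>[of u] \<Gamma>[of x'] by (simp add: inner_simps algebra_simps)
    also have "\<gamma> u - \<gamma> x' = L * ((xt - y') \<bullet> (u - x')) + \<mu> / 2 * ((norm (u - y'))\<^sup>2 - (norm (x' - y'))\<^sup>2)"
      unfolding \<gamma>_def y' by (simp add: inner_diff_right algebra_simps)
    finally have "A' * \<Gamma>' u - A' * \<Gamma>' x'
        = ((y0 - x) + (A * \<mu>) *\<^sub>R (x' - x) + (a * L) *\<^sub>R (xt - y') + (a * \<mu>) *\<^sub>R (x' - y')) \<bullet> (u - x')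
          + A' * \<mu> / 2 * (norm (u - x'))\<^sup>2"
      unfolding sq A' inner_add_left inner_scaleR_left by (simp add: field_simps)
    then show ?thesis unfolding stat by simp
  qed
  moreover have "A' * \<Gamma>' u \<le> A' * (\<psi>s u + hn u)" if "u \<in> Z" for u
  proof -
    have "A' * \<Gamma>' u \<le> A * (\<psi>s u + hn u) + a * (\<psi>s u + hn u)"
      unfolding A'\<Gamma>' using \<Gamma>_le[OF that] \<gamma>_le[OF that] a by (intro add_mono mult_left_mono[of "\<gamma> u"]) auto
    then show ?thesis by (simp add: A' algebra_simps)
  qed
  moreover have "0 \<le> A'" using A'pos by simp
  ultimately show ?thesis
    using A'pos y'Z unfolding acg_invariant_def prod.case by blast
qed

text \<open>Dropping the quadratic term of \<Gamma> leaves an affine minorant of \<psi> on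
  \<open>Z\<close> with slope \<open>v\<close>, and its gap to \<psi> at the output point is exactly
  \<epsilon>. The lower model is assumed only at points where the call linearises.\<close>

lemma acg3_approx_subgradient:
  fixes \<psi>s :: "'a::euclidean_space \<Rightarrow> real"
  assumes Z: "compact Z" "Z \<noteq> {}"
    and \<psi>n: "\<And>u. u \<in> Z \<Longrightarrow> \<psi>n u = ereal (hn u)" "\<And>u. u \<notin> Z \<Longrightarrow> \<psi>n u = \<infinity>"
    and hn: "convex_on Z hn" "continuous_on Z hn"
    and L: "0 < L" and \<mu>: "0 \<le> \<mu>"
    and low: "\<And>x u. x \<in> acg3_lin_points \<psi>s \<psi>n y0 \<mu> L \<sigma> \<Longrightarrow> u \<in> Z \<Longrightarrow>
      linearization \<psi>s x u + \<mu> / 2 * (norm (u - x))\<^sup>2 \<le> \<psi>s u"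
    and ret: "acg3_returns \<psi>s \<psi>n y0 \<mu> L \<sigma> (z, v, \<epsilon>)"
  shows "z \<in> Z"
    and "(norm v)\<^sup>2 + 2 * \<epsilon> \<le> \<sigma> * (norm (y0 - z + v))\<^sup>2"
    and "\<And>u. u \<in> Z \<Longrightarrow> \<psi>s z + hn z + v \<bullet> (u - z) - \<epsilon> \<le> \<psi>s u + hn u"
proof -
  let ?inv = "acg_invariant Z (\<lambda>u. \<psi>s u + hn u) y0 \<mu>"
  obtain j where j: "1 \<le> j" "acg3_stop \<psi>s \<psi>n y0 \<mu> L \<sigma> j"
    "\<And>i. i \<in> {1..<j} \<Longrightarrow> \<not> acg3_stop \<psi>s \<psi>n y0 \<mu> L \<sigma> i"
    "(z, v, \<epsilon>) = acg_triple \<psi>s \<psi>n y0 \<mu> L j"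
    using ret unfolding acg3_returns_def by blast
  have step: "?inv (A', x', y', \<Gamma>') \<and> 0 < A' \<and> y' \<in> Z"
    if "?inv (acg \<psi>s \<psi>n y0 \<mu> L i)" "i < j" "acg \<psi>s \<psi>n y0 \<mu> L (Suc i) = (A', x', y', \<Gamma>')"
    for i A' x' y' \<Gamma>'
  proof (rule acg_invariant_step[OF Z \<psi>n hn L \<mu> that(1)])
    have "acg_extrap \<mu> L (acg \<psi>s \<psi>n y0 \<mu> L i) \<in> acg3_lin_points \<psi>s \<psi>n y0 \<mu> L \<sigma>"
      unfolding acg3_lin_points_def using j(3) that(2) by fastforce
    then show "\<And>u. u \<in> Z \<Longrightarrow> linearization \<psi>s (acg_extrap \<mu> L (acg \<psi>s \<psi>n y0 \<mu> L i)) u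
        + \<mu> / 2 * (norm (u - acg_extrap \<mu> L (acg \<psi>s \<psi>n y0 \<mu> L i)))\<^sup>2 \<le> \<psi>s u"
      by (rule low)
  qed (use that(3) in simp_all)
  have inv: "?inv (acg \<psi>s \<psi>n y0 \<mu> L i)" if "i \<le> j" for i
    using that
  proof (induction i)
    case 0
    then show ?case by (simp add: acg_invariant_def)
  next
    case (Suc i)
    obtain A x y \<Gamma> where "acg \<psi>s \<psi>n y0 \<mu> L (Suc i) = (A, x, y, \<Gamma>)"
      by (rule prod_cases4)
    then show ?case using step[of i A x y \<Gamma>] Suc by (simp del: acg.simps)
  qed
  obtain A x y \<Gamma> where s: "acg \<psi>s \<psi>n y0 \<mu> L j = (A, x, y, \<Gamma>)"
    by (rule prod_cases4)
  obtain i where i: "j = Suc i" using j(1) by (cases j) auto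
  \<comment> \<open>Since \<open>j \<ge> 1\<close>, the final state results from a step; this
    supplies \<open>0 < A\<close> and \<open>y \<in> Z\<close>, which the invariant alone does
    not.\<close>
  have sj: "?inv (A, x, y, \<Gamma>)" "0 < A" "y \<in> Z"
    using step[OF inv[of i], of A x y \<Gamma>] s i by (auto simp del: acg.simps)
  then have out: "z = y" "v = (1 / A) *\<^sub>R (y0 - x)" "\<epsilon> = \<psi>s y + hn y - \<Gamma> x - v \<bullet> (y - x)"
    using j(4) s \<psi>n(1)[of y] by (auto simp: acg_triple_def Let_def)
  show "z \<in> Z" using sj out by simp
  show "(norm v)\<^sup>2 + 2 * \<epsilon> \<le> \<sigma> * (norm (y0 - z + v))\<^sup>2"
    using j(2) unfolding acg3_stop_def j(4)[symmetric] by simp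
  fix u assume u: "u \<in> Z"
  have \<Gamma>: "A * \<Gamma> u = A * \<Gamma> x + (y0 - x) \<bullet> (u - x) + A * \<mu> / 2 * (norm (u - x))\<^sup>2"
    using sj(1) unfolding acg_invariant_def prod.case by blast
  have "A * (\<Gamma> x + v \<bullet> (u - x)) = A * \<Gamma> x + (y0 - x) \<bullet> (u - x)"
    using sj(2) out(2) by (simp add: distrib_left)
  also have "\<dots> \<le> A * \<Gamma> x + (y0 - x) \<bullet> (u - x) + A * \<mu> / 2 * (norm (u - x))\<^sup>2"
    using sj(2) \<mu> by simp
  also have "\<dots> = A * \<Gamma> u"
    by (rule \<Gamma>[symmetric])
  also have "\<dots> \<le> A * (\<psi>s u + hn u)"
    using sj(1) u unfolding acg_invariant_def prod.case by blast
  finally have "\<Gamma> x + v \<bullet> (u - x) \<le> \<psi>s u + hn u"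
    using sj(2) by simp
  then show "\<psi>s z + hn z + v \<bullet> (u - z) - \<epsilon> \<le> \<psi>s u + hn u"
    by (simp add: out(1,3) inner_diff_right)
qed

subsection \<open>One iteration of the method\<close>

lemma Conv_bar_real:
  assumes "h \<in> Conv_bar Z"
  shows "u \<in> Z \<Longrightarrow> h u = ereal (real_of_ereal (h u))" and "u \<notin> Z \<Longrightarrow> h u = \<infinity>"
proof -
  have "h u \<noteq> -\<infinity>" "{z. h z \<noteq> \<infinity>} = Z"
    using assms unfolding Conv_bar_def by auto
  then show "u \<in> Z \<Longrightarrow> h u = ereal (real_of_ereal (h u))" and "u \<notin> Z \<Longrightarrow> h u = \<infinity>"
    by (cases "h u"; auto)+
qed

lemma Conv_bar_convex_on:
  assumes h: "h \<in> Conv_bar Z" and Z: "convex Z"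
  shows "convex_on Z (\<lambda>u. real_of_ereal (h u))"
proof
  fix t x y assume t: "0 < t" "t < (1::real)" and xy: "x \<in> Z" "y \<in> Z"
  let ?H = "\<lambda>u. real_of_ereal (h u)" and ?w = "(1 - t) *\<^sub>R x + t *\<^sub>R y"
  have w: "?w \<in> Z" using Z xy t by (simp add: convex_def)
  have "h (t *\<^sub>R y + (1 - t) *\<^sub>R x) \<le> ereal t * h y + ereal (1 - t) * h x"
    using h t unfolding Conv_bar_def by auto
  then have "h ?w \<le> ereal t * h y + ereal (1 - t) * h x"
    by (simp add: add.commute)
  then have "ereal (?H ?w) \<le> ereal t * ereal (?H y) + ereal (1 - t) * ereal (?H x)"
    using Conv_bar_real(1)[OF h] w xy by metis
  then show "?H ?w \<le> (1 - t) * ?H x + t * ?H y" by simp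
qed (fact Z)

text \<open>Testing the \<open>\<epsilon>\<close>-subgradient inequality at \<open>z + (u - z) / L\<close> turns \<open>\<epsilon>\<close> into \<open>L \<epsilon>\<close>, which
  the relative error criterion with \<open>\<sigma> = \<theta>\<^sup>2 / L\<close> bounds independently of \<open>L\<close>.\<close>

lemma approx_stationarity:
  fixes z zp v :: "'a::euclidean_space"
  assumes D: "\<And>u w. u \<in> Z \<Longrightarrow> w \<in> Z \<Longrightarrow> norm (u - w) \<le> D"
    and zZ: "z \<in> Z" "zp \<in> Z" and H: "convex_on Z H"
    and lam: "0 < lam" and L: "L = lam * Lc + 1" "0 \<le> Lc" and \<theta>: "0 < \<theta>" "\<theta> < 1"
    and crit: "(norm v)\<^sup>2 + 2 * \<epsilon> \<le> \<theta>\<^sup>2 / L * (norm (zp - z + v))\<^sup>2"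
    and sub: "\<And>u. u \<in> Z \<Longrightarrow>
      (lam * F z + 1 / 2 * (norm (z - zp))\<^sup>2) + lam * H z + v \<bullet> (u - z) - \<epsilon>
        \<le> (lam * F u + 1 / 2 * (norm (u - zp))\<^sup>2) + lam * H u"
    and up: "\<And>w. w \<in> Z \<Longrightarrow> F w - F z \<le> d \<bullet> (w - z) + Lc / 2 * (norm (w - z))\<^sup>2"
    and u: "u \<in> Z"
  shows "- ((\<theta>\<^sup>2 / (2 * (1 - \<theta>)\<^sup>2) + (1 / 2 + 1 / (1 - \<theta>))) * (D\<^sup>2 / lam)) \<le> d \<bullet> (u - z) + H u - H z"
proof -
  have L1: "1 \<le> L" using L lam by simp
  define r where "r = norm (zp - z + v)"
  define t where "t = 1 / L"
  have t: "0 < t" "t \<le> 1" "L * t = 1" using L1 by (auto simp: t_def)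
  have D0: "0 \<le> D" using D[OF u u] by simp
  \<comment> \<open>Testing the inclusion at \<open>z\<close> itself cancels everything but
    \<epsilon>.\<close>
  have \<epsilon>: "0 \<le> \<epsilon>" using sub[OF zZ(1)] by simp
  have "\<theta>\<^sup>2 / L * r\<^sup>2 \<le> \<theta>\<^sup>2 / 1 * r\<^sup>2"
    using L1 by (intro mult_right_mono divide_left_mono) auto
  then have "(norm v)\<^sup>2 \<le> (\<theta> * r)\<^sup>2"
    using crit \<epsilon> unfolding r_def by (simp add: power_mult_distrib)
  then have v: "norm v \<le> \<theta> * r"
    using \<theta> by (simp add: power2_le_iff_abs_le r_def)
  have "r \<le> norm (zp - z) + norm v" unfolding r_def by (rule norm_triangle_ineq)
  \<comment> \<open>The term \<open>norm v\<close>, at most \<open>\<theta> * r\<close>, is absorbed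
    into the left-hand side.\<close>
  then have "r * (1 - \<theta>) \<le> D"
    using v D[OF zZ(2,1)] by (simp add: algebra_simps)
  then have r: "r \<le> D / (1 - \<theta>)" using \<theta> by (simp add: pos_le_divide_eq)
  have "2 * \<epsilon> \<le> \<theta>\<^sup>2 / L * r\<^sup>2"
    using crit unfolding r_def by (smt (verit) zero_le_power2)
  then have "L * (2 * \<epsilon>) \<le> L * (\<theta>\<^sup>2 / L * r\<^sup>2)" using L1 by (intro mult_left_mono) auto
  also have "\<dots> = \<theta>\<^sup>2 * r\<^sup>2" using L1 by simp
  also have "\<dots> \<le> \<theta>\<^sup>2 * (D / (1 - \<theta>))\<^sup>2"
    using r by (intro mult_left_mono power_mono) (auto simp: r_def)
  finally have L\<epsilon>: "L * \<epsilon> \<le> \<theta>\<^sup>2 / (2 * (1 - \<theta>)\<^sup>2) * D\<^sup>2"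
    by (simp add: power_divide)
  define w where "w = (1 - t) *\<^sub>R z + t *\<^sub>R u"
  have wz: "w - z = t *\<^sub>R (u - z)" by (simp add: w_def algebra_simps)
  have wZ: "w \<in> Z"
    using H zZ u t unfolding w_def by (simp add: convex_on_def convex_def)
  let ?n = "(norm (u - z))\<^sup>2"
  have Fw: "F w - F z \<le> t * (d \<bullet> (u - z)) + Lc / 2 * (t\<^sup>2 * ?n)"
    using up[OF wZ] unfolding wz by (simp add: power_mult_distrib)
  have Hw: "H w - H z \<le> t * (H u - H z)"
    using convex_onD[OF H, of t z u] t zZ u unfolding w_def by (simp add: algebra_simps)
  have "w - zp = (z - zp) + t *\<^sub>R (u - z)" using wz by (simp add: algebra_simps)
  then have nw: "(norm (w - zp))\<^sup>2 = (norm (z - zp))\<^sup>2 + 2 * (t * ((z - zp) \<bullet> (u - z))) + t\<^sup>2 * ?n"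
    unfolding power2_norm_eq_inner
    by (simp only: inner_add_left inner_add_right inner_scaleR_left inner_scaleR_right
        inner_commute[of "u - z" "z - zp"] power2_eq_square) (simp add: distrib_left mult.assoc)
  have "t * (v \<bullet> (u - z)) - \<epsilon>
      \<le> lam * (F w - F z) + (t * ((z - zp) \<bullet> (u - z)) + 1 / 2 * (t\<^sup>2 * ?n)) + lam * (H w - H z)"
    using sub[OF wZ] unfolding wz nw inner_scaleR_right right_diff_distrib distrib_left
    by (simp add: field_simps)
  also have "\<dots> \<le> lam * (t * (d \<bullet> (u - z)) + Lc / 2 * (t\<^sup>2 * ?n))
      + (t * ((z - zp) \<bullet> (u - z)) + 1 / 2 * (t\<^sup>2 * ?n)) + lam * (t * (H u - H z))"
    using lam by (intro add_mono order_refl mult_left_mono[OF Fw] mult_left_mono[OF Hw]) auto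
  also have "\<dots> = t * (lam * (d \<bullet> (u - z) + H u - H z) + (z - zp) \<bullet> (u - z)) + L * t * t / 2 * ?n"
    unfolding L(1) by (simp add: power2_eq_square field_simps)
  \<comment> \<open>Because \<open>L * t = 1\<close>, multiplying by \<open>L\<close> turns the
    curvature term into \<open>1 / 2 * ?n\<close>. Then \<open>L\<close> survives only in front of
    \<epsilon>, where the stopping criterion controls it.\<close>
  finally have "L * (t * (v \<bullet> (u - z)) - \<epsilon>)
      \<le> L * (t * (lam * (d \<bullet> (u - z) + H u - H z) + (z - zp) \<bullet> (u - z)) + t / 2 * ?n)"
    using L1 t(3) by (intro mult_left_mono) auto
  also have "\<dots> = (L * t) * (lam * (d \<bullet> (u - z) + H u - H z) + (z - zp) \<bullet> (u - z)) + (L * t) / 2 * ?n"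
    by (simp add: distrib_left mult.assoc)
  also have "L * (t * (v \<bullet> (u - z)) - \<epsilon>) = (L * t) * (v \<bullet> (u - z)) - L * \<epsilon>"
    by (simp add: right_diff_distrib mult.assoc)
  finally have main: "v \<bullet> (u - z) - L * \<epsilon>
      \<le> lam * (d \<bullet> (u - z) + H u - H z) + (z - zp) \<bullet> (u - z) + 1 / 2 * ?n"
    unfolding t(3) by simp
  \<comment> \<open>The subgradient and proximal cross terms combine into the residual vector of
    norm \<open>r\<close>; bounding them together gives the summand
    \<open>1 / (1 - \<theta>)\<close>.\<close>
  have "- ((zp - z + v) \<bullet> (u - z)) \<le> r * norm (u - z)"
    unfolding r_def by (metis inner_minus_left norm_cauchy_schwarz norm_minus_cancel)
  also have "\<dots> \<le> D / (1 - \<theta>) * D"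
    using r D[OF u zZ(1)] D0 \<theta> by (intro mult_mono) auto
  finally have "- ((zp - z + v) \<bullet> (u - z)) \<le> 1 / (1 - \<theta>) * D\<^sup>2"
    by (simp add: power2_eq_square)
  moreover have "(zp - z + v) \<bullet> (u - z) = v \<bullet> (u - z) - (z - zp) \<bullet> (u - z)"
    by (simp add: inner_simps)
  moreover have "?n \<le> D\<^sup>2" using D[OF u zZ(1)] by (intro power_mono) auto
  ultimately have "- (\<theta>\<^sup>2 / (2 * (1 - \<theta>)\<^sup>2) * D\<^sup>2 + 1 / 2 * D\<^sup>2 + 1 / (1 - \<theta>) * D\<^sup>2)
      \<le> lam * (d \<bullet> (u - z) + H u - H z)"
    using main L\<epsilon> by linarith
  then have "- ((\<theta>\<^sup>2 / (2 * (1 - \<theta>)\<^sup>2) + (1 / 2 + 1 / (1 - \<theta>))) * D\<^sup>2)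
      \<le> lam * (d \<bullet> (u - z) + H u - H z)"
    by (simp only: distrib_right)
  then have "- ((\<theta>\<^sup>2 / (2 * (1 - \<theta>)\<^sup>2) + (1 / 2 + 1 / (1 - \<theta>))) * D\<^sup>2) / lam
      \<le> d \<bullet> (u - z) + H u - H z"
    using lam by (simp only: pos_divide_le_eq mult.commute)
  then show ?thesis by simp
qed

text \<open>Moving from \<open>zbar\<close> against the gradient inside the ball gains \<delta>
  times the norm of the gradient, while the sign of \<open>g zbar \<bullet> p\<close> gains its
  absolute value. The regularity condition converts these gains into a multiple of
  \<open>norm p\<close>.\<close>

lemma multiplier_bound:
  fixes g :: "'a::euclidean_space \<Rightarrow> 'b::euclidean_space"
  assumes K: "closed K" "convex_cone K" and c: "0 < c"
    and g: "g differentiable (at z)" "cone_convex K g"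
    and ball: "cball zbar \<delta> \<subseteq> Z" "0 \<le> \<delta>" and \<tau>: "0 \<le> \<tau>"
    and slater: "cone_le K (g zbar) 0"
    and stat: "\<And>u. u \<in> Z \<Longrightarrow> - \<kappa> \<le> blinfun_apply (grad_map g z) p \<bullet> (u - z)"
    and p: "p = mult_update g K c pp z"
    and reg: "\<tau> * norm p \<le> max (norm (blinfun_apply (grad_map g z) p)) \<bar>g zbar \<bullet> p\<bar>"
  shows "min 1 \<delta> * \<tau> * norm p + (norm p)\<^sup>2 / c \<le> \<kappa> + 1 / c * (p \<bullet> pp)"
proof -
  let ?G = "blinfun_apply (grad_map g z) p"
  have pK: "p \<in> dual_cone K"
    unfolding p mult_update_def by (rule Moreau_cone(1)[OF K])
  \<comment> \<open>The orthogonality in Moreau's decomposition plays the role of complementary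
    slackness and evaluates \<open>p \<bullet> g z\<close>.\<close>
  have "p \<bullet> (p - (pp + c *\<^sub>R g z)) = 0"
    unfolding p mult_update_def by (rule Moreau_cone(3)[OF K])
  then have "c * (p \<bullet> g z) = (norm p)\<^sup>2 - p \<bullet> pp"
    by (simp add: power2_norm_eq_inner inner_simps)
  then have pg: "p \<bullet> g z = (norm p)\<^sup>2 / c - 1 / c * (p \<bullet> pp)"
    using c by (simp add: field_simps)
  have "0 \<le> (- g zbar) \<bullet> p"
    using slater pK by (auto simp: cone_le_def dual_cone_def)
  then have gz: "\<bar>g zbar \<bullet> p\<bar> = - (p \<bullet> g zbar)" by (simp add: inner_commute)
  \<comment> \<open>As \<open>sgn 0 = 0\<close>, a vanishing gradient is covered too, with
    \<open>u = zbar\<close>.\<close>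
  define u where "u = zbar - \<delta> *\<^sub>R sgn ?G"
  have "dist zbar u \<le> \<delta>"
    using ball(2) by (simp add: u_def dist_norm norm_sgn)
  then have "u \<in> Z" using ball(1) by auto
  then have "- \<kappa> \<le> ?G \<bullet> (u - z)" by (rule stat)
  also have "?G \<bullet> (u - z) = ?G \<bullet> (zbar - z) - \<delta> * norm ?G"
    by (cases "?G = 0")
      (simp_all add: u_def inner_simps sgn_div_norm power2_norm_eq_inner[symmetric] power2_eq_square)
  also have "?G \<bullet> (zbar - z) \<le> p \<bullet> g zbar - p \<bullet> g z"
    by (rule cone_convex_gradient_le[OF g pK])
  finally have 1: "\<delta> * norm ?G + \<bar>g zbar \<bullet> p\<bar> \<le> \<kappa> - p \<bullet> g z"
    using gz by linarith
  \<comment> \<open>The two entries of the maximum carry the coefficients \<delta> and 1 in the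
    gain, so their minimum works whichever entry is larger.\<close>
  have "min 1 \<delta> * (\<tau> * norm p) \<le> min 1 \<delta> * max (norm ?G) \<bar>g zbar \<bullet> p\<bar>"
    using reg ball(2) by (intro mult_left_mono) auto
  also have "\<dots> \<le> \<delta> * norm ?G + \<bar>g zbar \<bullet> p\<bar>"
  proof (cases "norm ?G \<le> \<bar>g zbar \<bullet> p\<bar>")
    case True
    then have "min 1 \<delta> * max (norm ?G) \<bar>g zbar \<bullet> p\<bar> \<le> 1 * \<bar>g zbar \<bullet> p\<bar>"
      by (intro mult_mono) auto
    moreover have "0 \<le> \<delta> * norm ?G" using ball(2) by simp
    ultimately show ?thesis by linarith
  next
    case False
    then have "min 1 \<delta> * max (norm ?G) \<bar>g zbar \<bullet> p\<bar> \<le> \<delta> * norm ?G"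
      using ball(2) by (intro mult_mono) auto
    then show ?thesis by linarith
  qed
  finally show ?thesis using 1 pg by (simp add: mult.assoc)
qed

section \<open>Distance to the boundary and suprema over compact sets\<close>

lemma cball_infdist_frontier_subset:
  fixes Z :: "'a::euclidean_space set"
  assumes "closed Z" "x \<in> interior Z"
  shows "cball x (infdist x (frontier Z)) \<subseteq> Z"
proof (cases "infdist x (frontier Z) = 0")
  \<comment> \<open>Radius 0 is treated apart, since the open ball is then empty and its closure is
    not the closed ball.\<close>
  case True
  then show ?thesis using assms(2) interior_subset by auto
next
  case False
  then have pos: "0 < infdist x (frontier Z)" using infdist_nonneg[of x "frontier Z"] by linarith
  let ?B = "ball x (infdist x (frontier Z))"
  \<comment> \<open>A connected set that meets \<open>Z\<close> but misses its boundary lies in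
    \<open>Z\<close>; closedness then extends the inclusion to the closed ball.\<close>
  have "?B \<inter> frontier Z = {}"
    using infdist_le[of _ "frontier Z" x] by fastforce
  moreover have "?B \<inter> Z \<noteq> {}"
    using pos assms(2) interior_subset[of Z] centre_in_ball by blast
  ultimately have "?B \<subseteq> Z"
    using connected_Int_frontier[of ?B Z] by auto
  then have "closure ?B \<subseteq> Z" using assms(1) by (simp add: closure_minimal)
  then show ?thesis using pos by simp
qed

text \<open>By convention \<open>infdist\<close> to the empty set is 0, so the boundary must be
  shown nonempty; boundedness does this by excluding the whole space.\<close>

lemma infdist_frontier_pos:
  fixes Z :: "'a::euclidean_space set"
  assumes "bounded Z" "x \<in> interior Z"
  shows "0 < infdist x (frontier Z)"
proof -
  have "Z \<noteq> {}" using assms(2) interior_subset by auto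
  moreover have "Z \<noteq> UNIV" using assms(1) not_bounded_UNIV by auto
  ultimately have "frontier Z \<noteq> {}" by (simp add: frontier_eq_empty)
  moreover have "x \<notin> frontier Z" using assms(2) by (simp add: frontier_def)
  ultimately show ?thesis by (simp add: infdist_pos_not_in_closed)
qed

text \<open>Compactness bounds the range, as an upper bound by the conditionally complete supremum
  requires.\<close>

lemma norm_le_cSUP:
  fixes F :: "'a::topological_space \<Rightarrow> 'b::real_normed_vector"
  assumes "compact Z" "continuous_on Z F" "x \<in> Z"
  shows "norm (F x) \<le> (SUP z\<in>Z. norm (F z))"
proof (rule cSUP_upper[OF assms(3)])
  have "compact ((\<lambda>z. norm (F z)) ` Z)"
    using assms by (intro compact_continuous_image continuous_intros)
  then show "bdd_above ((\<lambda>z. norm (F z)) ` Z)"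
    by (intro bounded_imp_bdd_above compact_imp_bounded)
qed

section \<open>Multiplier bounds along a run\<close>

theorem proposition4p2p9:
  fixes f :: "'a::euclidean_space \<Rightarrow> real"
    and h :: "'a \<Rightarrow> ereal"
    and g :: "'a \<Rightarrow> real ^ 'l"
    and K :: "(real ^ 'l) set"
    and Z :: "'a set"
    and zbar z\<^sub>0 :: 'a
    and p\<^sub>0 :: "real ^ 'l"
    and m M K\<^sub>h L\<^sub>g \<tau> \<rho> \<eta> lam \<theta> c\<^sub>1 :: real
    and n :: nat
    and z :: "nat \<Rightarrow> 'a" and p :: "nat \<Rightarrow> real ^ 'l"
    and c :: "nat \<Rightarrow> real" and khat :: "nat \<Rightarrow> nat"
  defines "\<kappa>\<^sub>0 \<equiv> 2 * (K\<^sub>h + (SUP z\<in>Z. norm (grad f z))) * diameter Z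
      + (\<theta>\<^sup>2 / (2 * (1 - \<theta>)\<^sup>2) + 2 * ((1 + \<theta>) / (1 - \<theta>))) * ((diameter Z)\<^sup>2 / lam)"
    and "dbar \<equiv> infdist zbar (frontier Z)"
  assumes K: "closed K" "convex_cone K"
    and Z: "Z \<noteq> {}" "convex Z" "compact Z"
    and h: "h \<in> Conv_bar Z" "0 < K\<^sub>h" "K\<^sub>h-lipschitz_on Z (\<lambda>z. real_of_ereal (h z))"
    and f: "0 < m" "m \<le> M" "f \<in> C_class m M Z"
    and g: "\<forall>z. g differentiable (at z)" "continuous_on UNIV (grad_map g)"
      "cone_convex K g"
      "0 < L\<^sub>g" "\<forall>u z. norm (grad_map g u - grad_map g z) \<le> L\<^sub>g * norm (u - z)"
    and slater: "zbar \<in> interior Z" "\<tau> \<in> {0<..1}" "cone_le K (g zbar) 0"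
      "\<forall>z\<in>Z. \<forall>p\<in>dual_cone K.
         max (norm (blinfun_apply (grad_map g z) p)) \<bar>g zbar \<bullet> p\<bar> \<ge> \<tau> * norm p"
    and inputs: "0 < \<rho>" "0 < \<eta>" "lam \<in> {0<..<1 / m}" "\<theta> \<in> {0<..1 / sqrt 2}" "0 < c\<^sub>1" "z\<^sub>0 \<in> Z"
    and run: "aipal_run f h g K Z m M L\<^sub>g lam \<theta> \<rho> \<eta> c\<^sub>1 z\<^sub>0 p\<^sub>0 n z p c khat"
    and lin_points: "\<forall>x\<in>aipal_lin_points f h g K Z m M L\<^sub>g lam \<theta> n z p c.
        f differentiable (at x) \<and>
        (\<forall>u\<in>Z. - (m / 2) * (norm (u - x))\<^sup>2 \<le> f u - linearization f x u)"
  shows "(\<forall>k\<in>{1..n}.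
            min 1 dbar * \<tau> * norm (p k) + (norm (p k))\<^sup>2 / c k
              \<le> \<kappa>\<^sub>0 + 1 / c k * (p k \<bullet> p (k - 1))) \<and>
         (\<forall>k\<in>{0..n}. norm (p k) \<le> max (norm p\<^sub>0) \<kappa>\<^sub>0 / (min 1 dbar * \<tau>))"
proof -
  define H where "H = (\<lambda>u. real_of_ereal (h u))"
  define B0 where "B0 = (SUP z\<in>Z. norm (g z))"
  define B1 where "B1 = (SUP z\<in>Z. norm (grad_map g z))"
  define Bf where "Bf = (SUP z\<in>Z. norm (grad f z))"
  define D where "D = diameter Z"
  define Lc where "Lc k = AL_curv M L\<^sub>g g Z (c k) (p (k - 1))" for k
  define L where "L k = prox_curv M L\<^sub>g g Z lam (c k) (p (k - 1))" for k
  have lam: "0 < lam" "0 \<le> 1 - lam * m"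
    using inputs(3) f(1) by (auto simp: field_simps)
  have "1 < sqrt 2" by simp
  then have "1 / sqrt 2 < 1" by (subst divide_less_eq_1_pos) auto
  moreover have "0 < \<theta>" "\<theta> \<le> 1 / sqrt 2" using inputs(4) by auto
  ultimately have \<theta>: "0 < \<theta>" "\<theta> < 1" by linarith+
  have H: "convex_on Z H" "continuous_on Z H"
    unfolding H_def
    by (rule Conv_bar_convex_on[OF h(1) Z(2)], rule lipschitz_on_continuous_on[OF h(3)])
  have lamH: "convex_on Z (\<lambda>u. lam * H u)" "continuous_on Z (\<lambda>u. lam * H u)"
    using lam H by (auto intro!: convex_on_cmul continuous_intros)
  have \<psi>n: "ereal lam * h u = ereal (lam * H u)" if "u \<in> Z" for u
    using Conv_bar_real(1)[OF h(1) that] unfolding H_def by (metis times_ereal.simps(1))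
  have \<psi>n': "ereal lam * h u = \<infinity>" if "u \<notin> Z" for u
    using Conv_bar_real(2)[OF h(1) that] lam by simp
  have fC: "continuous_on Z (grad f)"
    "\<And>u z. u \<in> Z \<Longrightarrow> z \<in> Z \<Longrightarrow> f u - linearization f z u \<le> M / 2 * (norm (u - z))\<^sup>2"
    using f(3) unfolding C_class_def by auto
  have contg: "continuous_on Z g"
    using g(1) by (meson continuous_at_imp_continuous_on differentiable_imp_continuous_within)
  have B0: "\<And>x. x \<in> Z \<Longrightarrow> norm (g x) \<le> B0"
    unfolding B0_def by (rule norm_le_cSUP[OF Z(3) contg])
  have B1: "\<And>x. x \<in> Z \<Longrightarrow> norm (grad_map g x) \<le> B1"
    unfolding B1_def by (rule norm_le_cSUP[OF Z(3) continuous_on_subset[OF g(2)]]) auto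
  have Bf: "\<And>x. x \<in> Z \<Longrightarrow> norm (grad f x) \<le> Bf"
    unfolding Bf_def by (rule norm_le_cSUP[OF Z(3) fC(1)])
  have "0 \<le> B0" "0 \<le> Bf"
    using B0 Bf Z(1) norm_ge_zero order_trans by (metis all_not_in_conv)+
  have D: "norm (u - w) \<le> D" if "u \<in> Z" "w \<in> Z" for u w
    using diameter_bounded_bound[OF compact_imp_bounded[OF Z(3)] that] by (simp add: D_def dist_norm)
  have "0 \<le> D" using D Z(1) norm_ge_zero order_trans by (metis all_not_in_conv)
  have z0: "z 0 = z\<^sub>0" "p 0 = p\<^sub>0" and c1: "c 1 = c\<^sub>1"
    using run unfolding aipal_run_def by auto
  have c_step: "c (Suc k) = 2 * c k \<or> c (Suc k) = c k" if "k \<in> {1..<n}" for k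
  proof -
    \<comment> \<open>The doubling test is abstracted to an arbitrary proposition; both outcomes
      keep the penalty parameter positive.\<close>
    have "\<exists>P. if P then c (Suc k) = 2 * c k \<and> khat (Suc k) = k else c (Suc k) = c k \<and> khat (Suc k) = khat k"
      using run that unfolding aipal_run_def by blast
    then show ?thesis by (auto split: if_splits)
  qed
  have c_pos: "0 < c k" if "k \<in> {1..n}" for k
    using that
  proof (induction k)
    case (Suc k)
    then show ?case
      using c1 inputs(5) c_step[of k] by (cases "k = 0") auto
  qed simp
  have ret: "\<exists>v \<epsilon>. acg3_returns (prox_smooth f g K lam (c k) (z (k - 1)) (p (k - 1)))
      (\<lambda>u. ereal lam * h u) (z (k - 1)) (1 - lam * m) (L k) (\<theta>\<^sup>2 / L k) (z k, v, \<epsilon>)"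
    and pk: "p k = mult_update g K (c k) (p (k - 1)) (z k)" if "k \<in> {1..n}" for k
    using run that unfolding aipal_run_def L_def Let_def by blast+
  have Lc: "0 \<le> Lc k" "L k = lam * Lc k + 1" if "k \<in> {1..n}" for k
    unfolding Lc_def L_def prox_curv_def AL_curv_def B0_def[symmetric]
    using f(1,2) g(4) \<open>0 \<le> B0\<close> c_pos[OF that] by simp_all
  \<comment> \<open>The points \<open>x\<close> may leave \<open>Z\<close>; there the lower model of
    \<open>f\<close> comes from \<open>lin_points\<close>, not from its curvature class.\<close>
  have low: "linearization (prox_smooth f g K lam (c k) (z (k - 1)) (p (k - 1))) x u
      + (1 - lam * m) / 2 * (norm (u - x))\<^sup>2 \<le> prox_smooth f g K lam (c k) (z (k - 1)) (p (k - 1)) u"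
    if "k \<in> {1..n}" "x \<in> acg3_lin_points (prox_smooth f g K lam (c k) (z (k - 1)) (p (k - 1)))
      (\<lambda>u. ereal lam * h u) (z (k - 1)) (1 - lam * m) (L k) (\<theta>\<^sup>2 / L k)" "u \<in> Z" for k x u
  proof -
    have "x \<in> aipal_lin_points f h g K Z m M L\<^sub>g lam \<theta> n z p c"
      unfolding aipal_lin_points_def Let_def using that(1,2) unfolding L_def by blast
    then show ?thesis
      using lin_points that(3) g(1,3) c_pos[OF that(1)] lam(1)
      by (intro prox_smooth_lower K) auto
  qed
  \<comment> \<open>Membership of \<open>z k\<close> is carried along because the next iteration
    needs its prox centre in \<open>Z\<close> for the diameter bounds.\<close>
  have iter: "z k \<in> Z \<and> min 1 dbar * \<tau> * norm (p k) + (norm (p k))\<^sup>2 / c k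
      \<le> \<kappa>\<^sub>0 + 1 / c k * (p k \<bullet> p (k - 1))"
    if k: "k \<in> {1..n}" and zp: "z (k - 1) \<in> Z" for k
  proof -
    let ?F = "AL_smooth f g K (c k) (p (k - 1))"
    let ?G = "blinfun_apply (grad_map g (z k)) (p k)"
    define \<kappa> where "\<kappa> = (\<theta>\<^sup>2 / (2 * (1 - \<theta>)\<^sup>2) + (1 / 2 + 1 / (1 - \<theta>))) * (D\<^sup>2 / lam)"
    obtain v \<epsilon> where r: "acg3_returns (prox_smooth f g K lam (c k) (z (k - 1)) (p (k - 1)))
      (\<lambda>u. ereal lam * h u) (z (k - 1)) (1 - lam * m) (L k) (\<theta>\<^sup>2 / L k) (z k, v, \<epsilon>)"
      using ret[OF k] by blast
    have L: "0 < L k" using Lc[OF k] lam(1) by (simp add: add_nonneg_pos)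
    note acg = acg3_approx_subgradient[OF Z(3,1) \<psi>n \<psi>n' lamH L lam(2) low[OF k] r, simplified]
    have zZ: "z k \<in> Z" by (rule acg(1))
    have stat: "- \<kappa> \<le> (grad f (z k) + ?G) \<bullet> (u - z k) + H u - H (z k)" if u: "u \<in> Z" for u
      unfolding \<kappa>_def
    proof (rule approx_stationarity[OF D zZ zp H(1) lam(1) Lc(2,1)[OF k] \<theta>, where v = v and \<epsilon> = \<epsilon> and F = ?F])
      show "(norm v)\<^sup>2 + 2 * \<epsilon> \<le> \<theta>\<^sup>2 / L k * (norm (z (k - 1) - z k + v))\<^sup>2"
        using acg(2) by simp
      show "lam * ?F (z k) + 1 / 2 * (norm (z k - z (k - 1)))\<^sup>2 + lam * H (z k) + v \<bullet> (u - z k) - \<epsilon>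
          \<le> lam * ?F u + 1 / 2 * (norm (u - z (k - 1)))\<^sup>2 + lam * H u" if "u \<in> Z" for u
        using acg(3)[OF that] unfolding prox_smooth_def by simp
      show "?F w - ?F (z k) \<le> (grad f (z k) + ?G) \<bullet> (w - z k) + Lc k / 2 * (norm (w - z k))\<^sup>2"
        if "w \<in> Z" for w
        unfolding Lc_def AL_curv_def B0_def[symmetric] B1_def[symmetric] pk[OF k]
        using g zZ that B0 B1 fC(2)
        by (intro AL_smooth_upper[OF K c_pos[OF k], where Z = Z]) (auto simp: Z)
    qed (use u in auto)
    \<comment> \<open>The contributions of \<open>f\<close> and \<open>h\<close> are moved into the
      error, at cost \<open>Bf * D\<close> and \<open>K\<^sub>h * D\<close>, so that only the
      constraint gradient remains.\<close>
    have stat': "- ((Bf + K\<^sub>h) * D + \<kappa>) \<le> ?G \<bullet> (u - z k)" if u: "u \<in> Z" for u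
    proof -
      have "grad f (z k) \<bullet> (u - z k) \<le> norm (grad f (z k)) * norm (u - z k)"
        by (rule norm_cauchy_schwarz)
      also have "\<dots> \<le> Bf * D"
        using Bf[OF zZ] D[OF u zZ] \<open>0 \<le> Bf\<close> by (intro mult_mono) auto
      finally have "grad f (z k) \<bullet> (u - z k) \<le> Bf * D" .
      moreover have "H u - H (z k) \<le> dist (H u) (H (z k))" by (simp add: dist_real_def)
      moreover have "dist (H u) (H (z k)) \<le> K\<^sub>h * dist u (z k)"
        using lipschitz_onD[OF h(3) u zZ] by (simp add: H_def)
      moreover have "K\<^sub>h * dist u (z k) \<le> K\<^sub>h * D"
        using h(2) D[OF u zZ] by (intro mult_left_mono) (auto simp: dist_norm)
      ultimately show ?thesis
        using stat[OF u] by (simp add: inner_add_left distrib_right)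
    qed
    \<comment> \<open>The error obtained is compared termwise with the larger constant
      \<open>\<kappa>\<^sub>0\<close>.\<close>
    have "(Bf + K\<^sub>h) * D \<le> 2 * ((Bf + K\<^sub>h) * D)"
      using \<open>0 \<le> Bf\<close> \<open>0 \<le> D\<close> h(2) by simp
    moreover have "1 / 2 + 1 / (1 - \<theta>) \<le> 2 * ((1 + \<theta>) / (1 - \<theta>))"
    proof -
      have "1 / (1 - \<theta>) \<le> (1 + \<theta>) / (1 - \<theta>)" "1 \<le> 1 / (1 - \<theta>)"
        using \<theta> by (auto intro: divide_right_mono)
      then show ?thesis by linarith
    qed
    then have "\<kappa> \<le> (\<theta>\<^sup>2 / (2 * (1 - \<theta>)\<^sup>2) + 2 * ((1 + \<theta>) / (1 - \<theta>))) * (D\<^sup>2 / lam)"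
      unfolding \<kappa>_def using lam(1) \<theta>
      by (intro mult_right_mono add_left_mono) auto
    ultimately have \<kappa>\<^sub>0: "(Bf + K\<^sub>h) * D + \<kappa> \<le> \<kappa>\<^sub>0"
      unfolding \<kappa>\<^sub>0_def Bf_def[symmetric] D_def[symmetric] by (simp add: algebra_simps)
    have "min 1 dbar * \<tau> * norm (p k) + (norm (p k))\<^sup>2 / c k
        \<le> ((Bf + K\<^sub>h) * D + \<kappa>) + 1 / c k * (p k \<bullet> p (k - 1))"
    proof (rule multiplier_bound[OF K c_pos[OF k] _ g(3) _ _ _ slater(3) stat' pk[OF k]])
      show "cball zbar dbar \<subseteq> Z"
        unfolding dbar_def using Z(3) slater(1)
        by (intro cball_infdist_frontier_subset compact_imp_closed)
      have "p k \<in> dual_cone K"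
        unfolding pk[OF k] mult_update_def by (rule Moreau_cone(1)[OF K])
      then show "\<tau> * norm (p k) \<le> max (norm ?G) \<bar>g zbar \<bullet> p k\<bar>"
        using slater(4) zZ by blast
    qed (use g(1) slater(2) in \<open>auto simp: dbar_def infdist_nonneg\<close>)
    then show ?thesis using zZ \<kappa>\<^sub>0 by linarith
  qed
  have zZ: "z k \<in> Z" if "k \<le> n" for k
    using that
  proof (induction k)
    case 0
    then show ?case using z0 inputs(6) by simp
  next
    case (Suc k)
    then show ?case using iter[of "Suc k"] by simp
  qed
  have a: "min 1 dbar * \<tau> * norm (p k) + (norm (p k))\<^sup>2 / c k
      \<le> \<kappa>\<^sub>0 + 1 / c k * (p k \<bullet> p (k - 1))" if "k \<in> {1..n}" for k
    using iter[OF that] zZ[of "k - 1"] that by auto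
  define \<nu> where "\<nu> = min 1 dbar * \<tau>"
  define C where "C = max (norm p\<^sub>0) \<kappa>\<^sub>0 / \<nu>"
  have "0 < dbar"
    unfolding dbar_def using Z(3) slater(1) by (intro infdist_frontier_pos compact_imp_bounded)
  then have \<nu>: "0 < \<nu>" "\<nu> \<le> 1"
    using slater(2) by (auto simp: \<nu>_def intro: mult_le_one)
  have b: "norm (p k) \<le> C" if "k \<le> n" for k
    using that
  proof (induction k)
    case 0
    \<comment> \<open>Since \<nu> is at most 1 and the maximum is nonnegative, dividing by \<nu>
      does not decrease it; hence \<open>C\<close> dominates the initial multiplier.\<close>
    have "max (norm p\<^sub>0) \<kappa>\<^sub>0 * \<nu> \<le> max (norm p\<^sub>0) \<kappa>\<^sub>0 * 1"
      using \<nu> by (intro mult_left_mono) (auto simp: le_max_iff_disj)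
    then have "norm p\<^sub>0 * \<nu> \<le> max (norm p\<^sub>0) \<kappa>\<^sub>0"
      using \<nu> by (smt (verit) mult_right_mono)
    then show ?case using \<nu> z0 by (simp add: C_def pos_le_divide_eq)
  next
    case (Suc k)
    let ?P = "norm (p (Suc k))" and ?c = "c (Suc k)"
    have c: "0 < ?c" using c_pos Suc.prems by simp
    have "p (Suc k) \<bullet> p k \<le> ?P * norm (p k)" by (rule norm_cauchy_schwarz)
    also have "\<dots> \<le> ?P * C" using Suc by (intro mult_left_mono) auto
    finally have "1 / ?c * (p (Suc k) \<bullet> p k) \<le> 1 / ?c * (?P * C)"
      using c by (intro mult_left_mono) auto
    moreover have "\<kappa>\<^sub>0 \<le> \<nu> * C" using \<nu> by (simp add: C_def)
    ultimately have "\<nu> * ?P + ?P\<^sup>2 / ?c \<le> \<nu> * C + 1 / ?c * (?P * C)"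
      using a[of "Suc k"] Suc.prems unfolding \<nu>_def by simp
    \<comment> \<open>The difference of the two sides factors, and the second factor is positive, so
      the bound persists whatever the value of the penalty parameter.\<close>
    then have "(?P - C) * (\<nu> + ?P / ?c) \<le> 0"
      by (simp add: power2_eq_square algebra_simps diff_divide_distrib)
    moreover have "0 < \<nu> + ?P / ?c" using \<nu> c by (simp add: add_pos_nonneg)
    ultimately show ?case by (simp add: mult_le_0_iff)
  qed
  show ?thesis
    using a b unfolding C_def \<nu>_def by auto
qed

end
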